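(* Let $d\in\mathbb{N}$, $\alpha\in(0,2)$, $m\ge 0$. Let $\mathcal{K}\subset\mathbb{R}^d$ be a bounded set with non-empty interior which is reflection symmetric with respect to a hyperplane $\mathcal{H}$ with $0\in\mathcal{H}$, and let $\mathsf{S}:\mathbb{R}^d\to\mathbb{R}^d$ be the reflection with respect to $\mathcal{H}$. Suppose that $v>0$ is chosen such that $H_{m,\alpha}=L_{m,\alpha}-v\mathbf{1}_{\mathcal{K}}$ has a ground state $\varphi_0$. Then $\varphi_0(\mathsf{S}x)=\varphi_0(x)$ for all $x\in\mathbb{R}^d$.
   Context: For $z\ge 0$ let $\Phi_{m,\alpha}(z)=(z+m^{2/\alpha})^{\alpha/2}-m$, and let $L_{m,\alpha}=\Phi_{m,\alpha}(-\Delta)$ be the self-adjoint operator on $L^2(\mathbb{R}^d)$ given by the Fourier multiplier $\Phi_{m,\alpha}(|y|^2)$. The set $\mathcal{K}$ is understood to be Borel measurable. A ground state of $H_{m,\alpha}$ is a nonzero $\varphi_0\in\mathrm{Dom}(H_{m,\alpha})$ with $H_{m,\alpha}\varphi_0=\lambda_0\varphi_0$, where $\lambda_0=\inf\mathrm{Spec}\,H_{m,\alpha}$. If a ground state exists it is unique up to a scalar multiple, bounded and continuous, and it is always chosen to be strictly positive with $\|\varphi_0\|_{L^2}=1$. *)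

theory Defs
  imports "HOL-Analysis.Analysis"
begin

section \<open>Square-integrable functions and the Fourier-Plancherel transform\<close>

text \<open>
  Elements of the complex Hilbert space $L^2$ are represented by Borel functions; two functions
  represent the same element iff they agree almost everywhere.  All notions below respect this
  identification.
\<close>

definition L2 :: "('a::euclidean_space \<Rightarrow> complex) set" where
  "L2 = {f \<in> borel_measurable lborel. integrable lborel (\<lambda>x. (cmod (f x))\<^sup>2)}"

definition l2norm :: "('a::euclidean_space \<Rightarrow> complex) \<Rightarrow> real" where
  "l2norm f = sqrt (LINT x|lborel. (cmod (f x))\<^sup>2)"

definition fourier :: "('a::euclidean_space \<Rightarrow> complex) \<Rightarrow> 'a \<Rightarrow> complex" where
  "fourier f y =
     complex_of_real ((2 * pi) powr (- (real DIM('a) / 2))) * (LINT x|lborel. cis (- (y \<bullet> x)) * f x)"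

text \<open>
  The Fourier transform on $L^2$ is the continuous extension of \<^const>\<open>fourier\<close> from
  $L^1 \cap L^2$.  It is rendered as a relation because its value is only determined almost
  everywhere.
\<close>

definition fourier_L2 :: "('a::euclidean_space \<Rightarrow> complex) \<Rightarrow> ('a \<Rightarrow> complex) \<Rightarrow> bool" where
  "fourier_L2 f g \<longleftrightarrow> f \<in> L2 \<and> g \<in> L2 \<and>
     (\<exists>u :: nat \<Rightarrow> 'a \<Rightarrow> complex.
        (\<forall>n. u n \<in> L2 \<and> integrable lborel (u n)) \<and>
        (\<lambda>n. l2norm (\<lambda>x. u n x - f x)) \<longlonglongrightarrow> 0 \<and>
        (\<lambda>n. l2norm (\<lambda>y. fourier (u n) y - g y)) \<longlonglongrightarrow> 0)"


section \<open>Unbounded operators, spectrum and ground states\<close>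

text \<open>
  An unbounded operator $T$ is given by its graph, the set of all pairs $(f, Tf)$ with $f$ in the
  domain of $T$, where both components range over all representatives.
\<close>

type_synonym 'a l2_op = "(('a \<Rightarrow> complex) \<times> ('a \<Rightarrow> complex)) set"

text \<open>
  The resolvent set consists of those $\mu$ for which $T - \mu$ is a bijection from the
  domain onto $L^2$ with bounded inverse.  The norm estimate contains injectivity.
\<close>

definition resolvent_set :: "'a::euclidean_space l2_op \<Rightarrow> complex set" where
  "resolvent_set T = {\<mu>.
     (\<forall>h\<in>L2. \<exists>(f, g)\<in>T. AE x in lborel. g x - \<mu> * f x = h x) \<and>
     (\<exists>C. \<forall>(f, g)\<in>T. l2norm f \<le> C * l2norm (\<lambda>x. g x - \<mu> * f x))}"

definition spec :: "'a::euclidean_space l2_op \<Rightarrow> complex set" where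
  "spec T = - resolvent_set T"

text \<open>Only used for operators that are self-adjoint, hence have real spectrum, and bounded below.\<close>

definition inf_spec :: "'a::euclidean_space l2_op \<Rightarrow> real" where
  "inf_spec T = Inf {r. complex_of_real r \<in> spec T}"

definition ground_state :: "'a::euclidean_space l2_op \<Rightarrow> ('a \<Rightarrow> complex) \<Rightarrow> bool" where
  "ground_state T f \<longleftrightarrow>
     \<not> (AE x in lborel. f x = 0) \<and> (f, \<lambda>x. complex_of_real (inf_spec T) * f x) \<in> T"


section \<open>The operators\<close>

text \<open>
  The multiplication operator by $\sigma$ conjugated with the Fourier transform, on its maximal
  domain: \<open>f\<close> belongs to the domain iff $\sigma \hat f \in L^2$.
\<close>

definition fourier_multiplier :: "('a::euclidean_space \<Rightarrow> real) \<Rightarrow> 'a l2_op" where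
  "fourier_multiplier \<sigma> = {(f, g). \<exists>f' g'. fourier_L2 f f' \<and> fourier_L2 g g' \<and>
     (AE y in lborel. g' y = complex_of_real (\<sigma> y) * f' y)}"

definition Phi :: "real \<Rightarrow> real \<Rightarrow> real \<Rightarrow> real" where
  "Phi m \<alpha> z = (z + m powr (2 / \<alpha>)) powr (\<alpha> / 2) - m"

definition L_op :: "real \<Rightarrow> real \<Rightarrow> 'a::euclidean_space l2_op" where
  "L_op m \<alpha> = fourier_multiplier (\<lambda>y. Phi m \<alpha> ((norm y)\<^sup>2))"

text \<open>The potential is bounded, so the domain of \<open>H_op\<close> is that of \<^const>\<open>L_op\<close>.\<close>

definition H_op :: "real \<Rightarrow> real \<Rightarrow> real \<Rightarrow> 'a::euclidean_space set \<Rightarrow> 'a l2_op" where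
  "H_op m \<alpha> v K = {(f, g). g \<in> L2 \<and>
     (\<exists>h. (f, h) \<in> L_op m \<alpha> \<and>
       (AE x in lborel. g x = h x - complex_of_real (v * indicator K x) * f x))}"


section \<open>Reflections\<close>

text \<open>The orthogonal projection of \<open>x\<close> onto \<open>P\<close> is the midpoint of \<open>x\<close> and its mirror image.\<close>

definition reflection :: "'a::euclidean_space set \<Rightarrow> 'a \<Rightarrow> 'a" where
  "reflection P x = 2 *\<^sub>R closest_point P x - x"

lemma reflection_hyperplane:
  fixes a :: "'a::euclidean_space"
  assumes "a \<noteq> 0"
  shows "reflection {x. a \<bullet> x = b} x = x - (2 * (a \<bullet> x - b) / (a \<bullet> a)) *\<^sub>R a"
proof -
  let ?P = "{x. a \<bullet> x = b}"
  let ?y = "x - ((a \<bullet> x - b) / (a \<bullet> a)) *\<^sub>R a"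
  have aa: "a \<bullet> a \<noteq> 0" using assms by simp
  have y: "?y \<in> ?P" using aa by (simp add: inner_diff_right)
  have "dist x ?y \<le> dist x z" if "z \<in> ?P" for z
  proof -
    have "(a \<bullet> (x - z)) = a \<bullet> x - b" using that by (simp add: inner_diff_right)
    then have "\<bar>a \<bullet> x - b\<bar> \<le> norm a * norm (x - z)"
      using Cauchy_Schwarz_ineq2[of a "x - z"] by simp
    then have "\<bar>a \<bullet> x - b\<bar> / norm a \<le> norm (x - z)"
      using assms by (simp add: divide_le_eq mult.commute)
    moreover have "dist x ?y = \<bar>a \<bullet> x - b\<bar> / norm a"
      using assms by (simp add: dist_norm dot_square_norm power2_eq_square)
    ultimately show ?thesis by (simp add: dist_norm)
  qed
  then have "?y = closest_point ?P x"
    by (intro closest_point_unique convex_hyperplane closed_hyperplane y) auto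
  then have "reflection ?P x = 2 *\<^sub>R ?y - x"
    unfolding reflection_def by simp
  also have "\<dots> = x - (2 * (a \<bullet> x - b) / (a \<bullet> a)) *\<^sub>R a"
    by (simp add: scaleR_diff_right scaleR_2)
  finally show ?thesis .
qed

end

theory Submission
  imports Defs "HOL-Probability.Probability"
begin

text \<open>
  Write $\beta = \alpha/2$ and $M = m^{2/\alpha}$.  On the Fourier side, the identity
  $\int_0^\infty (1 - e^{-ts})\, t^{-1-\beta}\, dt = C s^\beta$ at $s = |y|^2 + M$ writes
  $L_{m,\alpha} + m$ weakly as a superposition of $1 - e^{-tM} P_t$, where $P_t$ is the heat semigroup.
  Put $\psi = \varphi_0 - \varphi_0 \circ S$, which solves the same eigenvalue equation.  Testing the
  equation of $\psi$ with $\mathrm{sgn}(\psi)\, \varphi_0$ and that of $\varphi_0$ with $|\psi|$, the potential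
  terms cancel, and what remains says that
  $\int p_t(x - z)\, \varphi_0(x)\, (|\psi(z)| - \mathrm{sgn}(\psi(x))\, \psi(z))\, dx\, dz$ vanishes for almost
  every $t > 0$.  The integrand is nonnegative and the heat kernel $p_t$ is strictly positive, so $\psi$
  cannot take both signs.  As $\psi$ is odd under $S$, it vanishes.
\<close>

section \<open>The space of square-integrable functions\<close>

text \<open>The equation is invariant under S, so uniqueness of the ground state would finish at
  once; but uniqueness is itself a Perron-Frobenius statement. The positivity argument behind it is
  therefore run directly on \<psi>. The obstacle is regularity: sgn(\<psi>)
  \<open>\<phi>\<^sub>0\<close> may jump, and nothing places it in a form domain. Only one side of
  each pairing carries regularity here. Since \<open>\<phi>\<^sub>0\<close> lies in the domain of L,
  the product of (|y|^2 + M)^\<beta> with its transform is square-integrable, and the integral over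
  t converges absolutely against every L2 test function. All terms are then finite and may be
  subtracted; the sign of the integrand is used only after subtraction. The same economy fixes the
  form of the tools. The semigroup P_t appears only as the bounded form <P_t f, g>, the reflection
  is moved onto the test function so that only the equation of \<open>\<phi>\<^sub>0\<close> is ever
  tested, and Plancherel's theorem comes from the heat kernel itself: damp by exp(-t |y|^2), use
  Fubini, let t tend to 0.\<close>

lemma borel_measurable_cnj [measurable (raw)]:
  "f \<in> borel_measurable M \<Longrightarrow> (\<lambda>x. cnj (f x)) \<in> borel_measurable M"
  by (rule borel_measurable_continuous_on[where f = cnj]) (auto intro: continuous_intros)

lemma L2_measurable [measurable_dest]: "f \<in> L2 \<Longrightarrow> f \<in> borel_measurable borel"
  by (simp add: L2_def)

lemma L2_integrable: "f \<in> L2 \<Longrightarrow> integrable lborel (\<lambda>x. (cmod (f x))\<^sup>2)"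
  by (simp add: L2_def)

lemma L2I:
  "f \<in> borel_measurable borel \<Longrightarrow> integrable lborel (\<lambda>x. (cmod (f x))\<^sup>2) \<Longrightarrow> f \<in> L2"
  by (simp add: L2_def)

lemma l2norm_nonneg [simp]: "0 \<le> l2norm f"
  by (simp add: l2norm_def)

lemma l2norm_power2: "(l2norm f)\<^sup>2 = (LINT x|lborel. (cmod (f x))\<^sup>2)"
  by (simp add: l2norm_def)

lemma L2_dominated:
  assumes "f \<in> borel_measurable borel" "integrable lborel w" "AE x in lborel. (cmod (f x))\<^sup>2 \<le> w x"
  shows "f \<in> L2"
proof (rule L2I)
  show "integrable lborel (\<lambda>x. (cmod (f x))\<^sup>2)"
    by (rule Bochner_Integration.integrable_bound[OF assms(2)]) (use assms in auto)
qed fact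

lemma L2_bounded_mult:
  assumes "f \<in> L2" "h \<in> borel_measurable borel" "\<And>x. cmod (h x) \<le> B"
  shows "(\<lambda>x. h x * f x) \<in> L2"
proof (rule L2_dominated[where w = "\<lambda>x. B\<^sup>2 * (cmod (f x))\<^sup>2"])
  show "(\<lambda>x. h x * f x) \<in> borel_measurable borel"
    using assms by measurable
  show "integrable lborel (\<lambda>x. B\<^sup>2 * (cmod (f x))\<^sup>2)"
    using L2_integrable[OF assms(1)] by simp
  show "AE x in lborel. (cmod (h x * f x))\<^sup>2 \<le> B\<^sup>2 * (cmod (f x))\<^sup>2"
    by (intro AE_I2) (auto simp: norm_mult power_mult_distrib intro!: mult_right_mono power_mono assms)
qed

lemma L2_cmult: "f \<in> L2 \<Longrightarrow> (\<lambda>x. c * f x) \<in> L2"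
  by (rule L2_bounded_mult[where B = "cmod c"]) auto

lemma sum_power2_le: "(a + b)\<^sup>2 \<le> 2 * a\<^sup>2 + 2 * (b::real)\<^sup>2"
  using sum_squares_bound[of a b] by (simp add: power2_sum)

lemma L2_add:
  assumes "f \<in> L2" "g \<in> L2"
  shows "(\<lambda>x. f x + g x) \<in> L2"
proof (rule L2_dominated)
  show "(\<lambda>x. f x + g x) \<in> borel_measurable borel"
    using assms by measurable
  show "integrable lborel (\<lambda>x. 2 * (cmod (f x))\<^sup>2 + 2 * (cmod (g x))\<^sup>2)"
    using assms by (intro Bochner_Integration.integrable_add integrable_mult_right L2_integrable)
  show "AE x in lborel. (cmod (f x + g x))\<^sup>2 \<le> 2 * (cmod (f x))\<^sup>2 + 2 * (cmod (g x))\<^sup>2"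
  proof (intro AE_I2)
    fix x
    have "(cmod (f x + g x))\<^sup>2 \<le> (cmod (f x) + cmod (g x))\<^sup>2"
      by (intro power_mono norm_triangle_ineq) auto
    then show "(cmod (f x + g x))\<^sup>2 \<le> 2 * (cmod (f x))\<^sup>2 + 2 * (cmod (g x))\<^sup>2"
      using sum_power2_le order_trans by blast
  qed
qed

lemma L2_diff:
  assumes "f \<in> L2" "g \<in> L2"
  shows "(\<lambda>x. f x - g x) \<in> L2"
  using L2_add[OF assms(1) L2_cmult[OF assms(2), of "-1"]] by simp

lemma integrable_L2_mult:
  assumes "f \<in> L2" "g \<in> L2"
  shows "integrable lborel (\<lambda>x. f x * cnj (g x))"
proof (rule Bochner_Integration.integrable_bound)
  show "integrable lborel (\<lambda>x. (cmod (f x))\<^sup>2 + (cmod (g x))\<^sup>2)"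
    using assms by (intro Bochner_Integration.integrable_add L2_integrable)
  show "(\<lambda>x. f x * cnj (g x)) \<in> borel_measurable lborel"
    using assms by measurable
  show "AE x in lborel. norm (f x * cnj (g x)) \<le> norm ((cmod (f x))\<^sup>2 + (cmod (g x))\<^sup>2)"
  proof (intro AE_I2)
    fix x
    have "2 * (cmod (f x) * cmod (g x)) \<le> (cmod (f x))\<^sup>2 + (cmod (g x))\<^sup>2"
      using sum_squares_bound[of "cmod (f x)" "cmod (g x)"] by simp
    moreover have "0 \<le> cmod (f x) * cmod (g x)" by simp
    ultimately have "cmod (f x) * cmod (g x) \<le> (cmod (f x))\<^sup>2 + (cmod (g x))\<^sup>2"
      by linarith
    then show "norm (f x * cnj (g x)) \<le> norm ((cmod (f x))\<^sup>2 + (cmod (g x))\<^sup>2)"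
      by (simp add: norm_mult)
  qed
qed

section \<open>The inner product, Cauchy-Schwarz and the triangle inequality\<close>

definition l2inner :: "('a::euclidean_space \<Rightarrow> complex) \<Rightarrow> ('a \<Rightarrow> complex) \<Rightarrow> complex" where
  "l2inner f g = (LINT x|lborel. f x * cnj (g x))"

text \<open>Optimising over \<open>c\<close> turns a family of AM-GM bounds into a Cauchy-Schwarz bound.\<close>

lemma le_mult_if_le_weighted:
  fixes X A B :: real
  assumes "\<And>c. 0 < c \<Longrightarrow> X \<le> c / 2 * A\<^sup>2 + 1 / (2 * c) * B\<^sup>2" "0 \<le> A" "0 \<le> B"
  shows "X \<le> A * B"
proof (rule field_le_epsilon)
  fix e :: real assume e: "0 < e"
  \<comment> \<open>The optimal weight is B / A. Adding \<delta> to both numbers keeps it defined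
    and positive when A or B is 0, and this choice gives \<delta> (A + B + 1) \<le> e, which absorbs
    the error.\<close>
  define \<delta> where "\<delta> = min 1 (e / (A + B + 1))"
  have d: "0 < \<delta>" "\<delta> \<le> 1" "\<delta> \<le> e / (A + B + 1)"
    using assms e by (auto simp: \<delta>_def)
  have "X \<le> ((B + \<delta>) / (A + \<delta>)) / 2 * A\<^sup>2 + 1 / (2 * ((B + \<delta>) / (A + \<delta>))) * B\<^sup>2"
    using assms d by (intro assms(1)) (auto intro!: divide_pos_pos)
  also have "\<dots> \<le> (B + \<delta>) / 2 * (A + \<delta>) + (A + \<delta>) / 2 * (B + \<delta>)"
  proof (rule add_mono)
    have "A\<^sup>2 \<le> (A + \<delta>)\<^sup>2" "B\<^sup>2 \<le> (B + \<delta>)\<^sup>2" using assms d by (auto intro!: power_mono)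
    then have *: "A\<^sup>2 / (A + \<delta>) \<le> A + \<delta>" "B\<^sup>2 / (B + \<delta>) \<le> B + \<delta>"
      using assms d by (auto simp: divide_le_eq power2_eq_square)
    have "((B + \<delta>) / (A + \<delta>)) / 2 * A\<^sup>2 = (B + \<delta>) / 2 * (A\<^sup>2 / (A + \<delta>))" by simp
    also have "\<dots> \<le> (B + \<delta>) / 2 * (A + \<delta>)" using * assms d by (intro mult_left_mono) auto
    finally show "((B + \<delta>) / (A + \<delta>)) / 2 * A\<^sup>2 \<le> (B + \<delta>) / 2 * (A + \<delta>)" .
    have "1 / (2 * ((B + \<delta>) / (A + \<delta>))) * B\<^sup>2 = (A + \<delta>) / 2 * (B\<^sup>2 / (B + \<delta>))" by simp
    also have "\<dots> \<le> (A + \<delta>) / 2 * (B + \<delta>)" using * assms d by (intro mult_left_mono) auto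
    finally show "1 / (2 * ((B + \<delta>) / (A + \<delta>))) * B\<^sup>2 \<le> (A + \<delta>) / 2 * (B + \<delta>)" .
  qed
  also have "\<dots> = A * B + \<delta> * (A + B + \<delta>)" by (simp add: field_simps)
  also have "\<dots> \<le> A * B + \<delta> * (A + B + 1)" using d by simp
  also have "\<dots> \<le> A * B + e"
    using d(3) assms(2,3) by (simp add: pos_le_divide_eq add_nonneg_pos)
  finally show "X \<le> A * B + e" .
qed

lemma weighted_am_gm:
  fixes a b c :: real
  assumes "0 < c"
  shows "a * b \<le> c / 2 * a\<^sup>2 + 1 / (2 * c) * b\<^sup>2"
proof -
  have "0 \<le> (c * a - b)\<^sup>2" by simp
  then have "2 * c * (a * b) \<le> c\<^sup>2 * a\<^sup>2 + b\<^sup>2" by (simp add: power2_eq_square algebra_simps)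
  then show ?thesis using assms by (simp add: field_simps power2_eq_square)
qed

text \<open>Cauchy-Schwarz with the moduli inside the integral: this stronger form is what the cross
  term of the triangle inequality requires.\<close>

lemma l2norm_abs_inner:
  assumes f: "f \<in> L2" and g: "g \<in> L2"
  shows "(LINT x|lborel. cmod (f x) * cmod (g x)) \<le> l2norm f * l2norm g"
proof (rule le_mult_if_le_weighted)
  fix c :: real assume c: "0 < c"
  have "(LINT x|lborel. cmod (f x) * cmod (g x))
      \<le> (LINT x|lborel. c / 2 * (cmod (f x))\<^sup>2 + 1 / (2 * c) * (cmod (g x))\<^sup>2)"
    using integrable_norm[OF integrable_L2_mult[OF f g]]
    by (intro integral_mono weighted_am_gm c Bochner_Integration.integrable_add integrable_mult_right
        L2_integrable f g) (simp add: norm_mult)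
  also have "\<dots> = c / 2 * (l2norm f)\<^sup>2 + 1 / (2 * c) * (l2norm g)\<^sup>2"
    using L2_integrable[OF f] L2_integrable[OF g] by (simp add: l2norm_power2)
  finally show "(LINT x|lborel. cmod (f x) * cmod (g x)) \<le> c / 2 * (l2norm f)\<^sup>2 + 1 / (2 * c) * (l2norm g)\<^sup>2" .
qed auto

lemma l2inner_bound:
  assumes "f \<in> L2" "g \<in> L2"
  shows "cmod (l2inner f g) \<le> l2norm f * l2norm g"
proof -
  have "cmod (l2inner f g) \<le> (LINT x|lborel. cmod (f x * cnj (g x)))"
    unfolding l2inner_def by (rule integral_norm_bound)
  also have "\<dots> \<le> l2norm f * l2norm g"
    using l2norm_abs_inner[OF assms] by (simp add: norm_mult)
  finally show ?thesis .
qed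

lemma l2norm_triangle:
  assumes f: "f \<in> L2" and g: "g \<in> L2"
  shows "l2norm (\<lambda>x. f x + g x) \<le> l2norm f + l2norm g"
proof (rule power2_le_imp_le)
  have int: "integrable lborel (\<lambda>x. cmod (f x) * cmod (g x))"
    using integrable_norm[OF integrable_L2_mult[OF f g]] by (simp add: norm_mult)
  have "(l2norm (\<lambda>x. f x + g x))\<^sup>2 \<le> (LINT x|lborel. (cmod (f x))\<^sup>2 + (cmod (g x))\<^sup>2 + 2 * (cmod (f x) * cmod (g x)))"
    unfolding l2norm_power2
  proof (rule integral_mono)
    fix x
    have "(cmod (f x + g x))\<^sup>2 \<le> (cmod (f x) + cmod (g x))\<^sup>2"
      by (intro power_mono norm_triangle_ineq) auto
    then show "(cmod (f x + g x))\<^sup>2 \<le> (cmod (f x))\<^sup>2 + (cmod (g x))\<^sup>2 + 2 * (cmod (f x) * cmod (g x))"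
      by (simp add: power2_sum)
  qed (intro Bochner_Integration.integrable_add L2_integrable integrable_mult_right L2_add f g int)+
  also have "\<dots> = (l2norm f)\<^sup>2 + (l2norm g)\<^sup>2 + 2 * (LINT x|lborel. cmod (f x) * cmod (g x))"
    using L2_integrable[OF f] L2_integrable[OF g] int by (simp add: l2norm_power2)
  also have "\<dots> \<le> (l2norm f + l2norm g)\<^sup>2"
    using l2norm_abs_inner[OF f g] by (simp add: power2_sum)
  finally show "(l2norm (\<lambda>x. f x + g x))\<^sup>2 \<le> (l2norm f + l2norm g)\<^sup>2" .
qed simp

lemma l2norm_minus_commute: "l2norm (\<lambda>x. f x - g x) = l2norm (\<lambda>x. g x - f x)"
  by (simp add: l2norm_def norm_minus_commute)

lemma l2norm_triangle_diff:
  assumes f: "f \<in> L2" and g: "g \<in> L2" and h: "h \<in> L2"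
  shows "l2norm (\<lambda>x. f x - g x) \<le> l2norm (\<lambda>x. f x - h x) + l2norm (\<lambda>x. h x - g x)"
  using l2norm_triangle[OF L2_diff[OF f h] L2_diff[OF h g]] by simp

lemma l2norm_abs_diff:
  assumes f: "f \<in> L2" and g: "g \<in> L2"
  shows "\<bar>l2norm f - l2norm g\<bar> \<le> l2norm (\<lambda>x. f x - g x)"
  using l2norm_triangle[OF L2_diff[OF f g] g] l2norm_triangle[OF L2_diff[OF g f] f]
    l2norm_minus_commute[of f g] by simp

lemma l2norm_tendsto:
  assumes "\<And>n. u n \<in> L2" "f \<in> L2" "(\<lambda>n. l2norm (\<lambda>x. u n x - f x)) \<longlonglongrightarrow> 0"
  shows "(\<lambda>n. l2norm (u n)) \<longlonglongrightarrow> l2norm f"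
  using assms(3)
  by (rule Lim_transform_bound[rotated, THEN LIM_zero_cancel])
     (use l2norm_abs_diff[OF assms(1,2)] in auto)

lemma l2inner_diff:
  assumes "f \<in> L2" "g \<in> L2" "h \<in> L2"
  shows "l2inner (\<lambda>x. f x - g x) h = l2inner f h - l2inner g h"
    and "l2inner h (\<lambda>x. f x - g x) = l2inner h f - l2inner h g"
  using integrable_L2_mult[OF assms(1,3)] integrable_L2_mult[OF assms(2,3)]
    integrable_L2_mult[OF assms(3,1)] integrable_L2_mult[OF assms(3,2)]
  by (simp_all add: l2inner_def algebra_simps)

text \<open>Abstracted so that it applies both to the inner product and to the heat form.\<close>

lemma bounded_form_tendsto:
  fixes Q :: "('a::euclidean_space \<Rightarrow> complex) \<Rightarrow> ('a \<Rightarrow> complex) \<Rightarrow> complex"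
  assumes d1: "\<And>f g h. f \<in> L2 \<Longrightarrow> g \<in> L2 \<Longrightarrow> h \<in> L2 \<Longrightarrow> Q (\<lambda>x. f x - g x) h = Q f h - Q g h"
    and d2: "\<And>f g h. f \<in> L2 \<Longrightarrow> g \<in> L2 \<Longrightarrow> h \<in> L2 \<Longrightarrow> Q h (\<lambda>x. f x - g x) = Q h f - Q h g"
    and b: "\<And>f g. f \<in> L2 \<Longrightarrow> g \<in> L2 \<Longrightarrow> cmod (Q f g) \<le> l2norm f * l2norm g"
    and u: "\<And>n. u n \<in> L2" "f \<in> L2" "(\<lambda>n. l2norm (\<lambda>x. u n x - f x)) \<longlonglongrightarrow> 0"
    and w: "\<And>n. w n \<in> L2" "g \<in> L2" "(\<lambda>n. l2norm (\<lambda>x. w n x - g x)) \<longlonglongrightarrow> 0"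
  shows "(\<lambda>n. Q (u n) (w n)) \<longlonglongrightarrow> Q f g"
proof (rule LIM_zero_cancel, rule Lim_null_comparison)
  have "cmod (Q (u n) (w n) - Q f g)
      \<le> l2norm (\<lambda>x. u n x - f x) * l2norm (w n) + l2norm f * l2norm (\<lambda>x. w n x - g x)" for n
  proof -
    have "Q (u n) (w n) - Q f g = Q (\<lambda>x. u n x - f x) (w n) + Q f (\<lambda>x. w n x - g x)"
      using d1[OF u(1,2) w(1)] d2[OF w(1,2) u(2)] by simp
    then show ?thesis
      using norm_triangle_mono[OF b[OF L2_diff[OF u(1,2)] w(1)] b[OF u(2) L2_diff[OF w(1,2)]]]
      by simp
  qed
  then show "\<forall>\<^sub>F n in sequentially. norm (Q (u n) (w n) - Q f g)
      \<le> l2norm (\<lambda>x. u n x - f x) * l2norm (w n) + l2norm f * l2norm (\<lambda>x. w n x - g x)"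
    by simp
  show "(\<lambda>n. l2norm (\<lambda>x. u n x - f x) * l2norm (w n) + l2norm f * l2norm (\<lambda>x. w n x - g x)) \<longlonglongrightarrow> 0"
    using tendsto_add[OF tendsto_mult[OF u(3) l2norm_tendsto[OF w]] tendsto_mult[OF tendsto_const w(3)]]
    by simp
qed

lemma l2inner_tendsto:
  assumes "\<And>n. u n \<in> L2" "f \<in> L2" "(\<lambda>n. l2norm (\<lambda>x. u n x - f x)) \<longlonglongrightarrow> 0"
    and "\<And>n. w n \<in> L2" "g \<in> L2" "(\<lambda>n. l2norm (\<lambda>x. w n x - g x)) \<longlonglongrightarrow> 0"
  shows "(\<lambda>n. l2inner (u n) (w n)) \<longlonglongrightarrow> l2inner f g"
  by (rule bounded_form_tendsto[where Q = l2inner]) (use assms l2inner_diff l2inner_bound in auto)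

section \<open>Limit theorems, completeness and density in L2\<close>

lemma L2_dominated_convergence:
  assumes [measurable]: "\<And>n. u n \<in> borel_measurable borel" "f \<in> borel_measurable borel"
    and w: "integrable lborel (\<lambda>x. (w x)\<^sup>2)"
    and lim: "AE x in lborel. (\<lambda>n. u n x) \<longlonglongrightarrow> f x"
    and bound: "\<And>n. AE x in lborel. cmod (u n x) \<le> w x"
  shows "(\<lambda>n. l2norm (\<lambda>x. u n x - f x)) \<longlonglongrightarrow> 0"
proof -
  have all: "AE x in lborel. \<forall>n. cmod (u n x) \<le> w x"
    using bound by (simp add: AE_all_countable)
  have f: "AE x in lborel. cmod (f x) \<le> w x"
    using all lim
  proof eventually_elim
    case (elim x)
    then show ?case by (intro LIMSEQ_le_const2[OF tendsto_norm]) auto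
  qed
  have "(\<lambda>n. LINT x|lborel. (cmod (u n x - f x))\<^sup>2) \<longlonglongrightarrow> (LINT x|(lborel::'a measure). 0)"
  proof (rule integral_dominated_convergence)
    show "integrable lborel (\<lambda>x. 4 * (w x)\<^sup>2)" using w by simp
    show "AE x in lborel. (\<lambda>n. (cmod (u n x - f x))\<^sup>2) \<longlonglongrightarrow> 0"
      using lim
    proof eventually_elim
      case (elim x)
      then have "(\<lambda>n. (cmod (u n x - f x))\<^sup>2) \<longlonglongrightarrow> (cmod (f x - f x))\<^sup>2"
        by (intro tendsto_intros)
      then show ?case by simp
    qed
    show "AE x in lborel. norm ((cmod (u n x - f x))\<^sup>2) \<le> 4 * (w x)\<^sup>2" for n
      using bound[of n] f
    proof eventually_elim
      case (elim x)
      then have "cmod (u n x - f x) \<le> 2 * w x"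
        using norm_triangle_ineq4[of "u n x" "f x"] by linarith
      then have "(cmod (u n x - f x))\<^sup>2 \<le> (2 * w x)\<^sup>2" by (intro power_mono) auto
      then show ?case by simp
    qed
  qed auto
  then have "(\<lambda>n. sqrt (LINT x|lborel. (cmod (u n x - f x))\<^sup>2)) \<longlonglongrightarrow> sqrt 0"
    by (intro tendsto_real_sqrt) simp
  then show ?thesis by (simp add: l2norm_def)
qed

text \<open>Membership of the limit in L2 is a conclusion. This matters in both uses: for the limit
  of a Cauchy sequence and for \<open>fourier u\<close>, whose square-integrability is not known
  beforehand.\<close>

lemma L2_Fatou:
  assumes u: "\<And>n. u n \<in> L2" and f: "f \<in> borel_measurable borel"
    and lim: "AE x in lborel. (\<lambda>n. u n x) \<longlonglongrightarrow> f x"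
    and B: "\<And>n. l2norm (u n) \<le> B"
  shows "f \<in> L2" and "l2norm f \<le> B"
proof -
  have [measurable]: "u n \<in> borel_measurable borel" "f \<in> borel_measurable borel" for n
    using u f by (auto simp: L2_measurable)
  have B0: "0 \<le> B" using B[of 0] l2norm_nonneg order_trans by blast
  have nn: "(\<integral>\<^sup>+x. ennreal ((cmod (f x))\<^sup>2) \<partial>lborel) \<le> ennreal (B\<^sup>2)"
  proof -
    have "(\<integral>\<^sup>+x. ennreal ((cmod (f x))\<^sup>2) \<partial>lborel) = (\<integral>\<^sup>+x. liminf (\<lambda>n. ennreal ((cmod (u n x))\<^sup>2)) \<partial>lborel)"
    proof (rule nn_integral_cong_AE)
      show "AE x in lborel. ennreal ((cmod (f x))\<^sup>2) = liminf (\<lambda>n. ennreal ((cmod (u n x))\<^sup>2))"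
        using lim
      proof eventually_elim
        case (elim x)
        then have "(\<lambda>n. ennreal ((cmod (u n x))\<^sup>2)) \<longlonglongrightarrow> ennreal ((cmod (f x))\<^sup>2)"
          by (intro tendsto_ennrealI tendsto_intros)
        then show ?case
          by (intro lim_imp_Liminf[OF sequentially_bot, symmetric])
      qed
    qed
    also have "\<dots> \<le> liminf (\<lambda>n. \<integral>\<^sup>+x. ennreal ((cmod (u n x))\<^sup>2) \<partial>lborel)"
      by (rule nn_integral_liminf) simp
    also have "\<dots> \<le> liminf (\<lambda>n. ennreal (B\<^sup>2))"
    proof (intro Liminf_mono always_eventually allI)
      fix n
      have "(\<integral>\<^sup>+x. ennreal ((cmod (u n x))\<^sup>2) \<partial>lborel) = ennreal ((l2norm (u n))\<^sup>2)"
        unfolding l2norm_power2 by (rule nn_integral_eq_integral) (auto intro: L2_integrable u)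
      then show "(\<integral>\<^sup>+x. ennreal ((cmod (u n x))\<^sup>2) \<partial>lborel) \<le> ennreal (B\<^sup>2)"
        using B[of n] B0 by (simp add: ennreal_leI power_mono)
    qed
    finally show ?thesis by (simp add: Liminf_const)
  qed
  show fL2: "f \<in> L2"
    by (rule L2I, simp, rule integrableI_bounded) (use le_less_trans[OF nn ennreal_less_top] in simp_all)
  have "ennreal ((l2norm f)\<^sup>2) \<le> ennreal (B\<^sup>2)"
    unfolding l2norm_power2 using nn nn_integral_eq_integral[OF L2_integrable[OF fL2]] by simp
  then have "(l2norm f)\<^sup>2 \<le> B\<^sup>2" by simp
  then show "l2norm f \<le> B" using B0 by (rule power2_le_imp_le)
qed

text \<open>Riesz-Fischer for sequences with geometric increments. The approximating sequences used
  later are chosen this fast, so no subsequence has to be extracted.\<close>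

lemma L2_complete:
  assumes u: "\<And>n. u n \<in> L2" and d: "\<And>n. l2norm (\<lambda>x. u (Suc n) x - u n x) \<le> (1 / 2) ^ n"
  shows "\<exists>g\<in>L2. (\<lambda>n. l2norm (\<lambda>x. u n x - g x)) \<longlonglongrightarrow> 0"
proof -
  have [measurable]: "u n \<in> borel_measurable borel" for n
    using u by (auto simp: L2_measurable)
  \<comment> \<open>The weight 2^n is balanced between two demands: the integrals 2^n 4^(-n) must
    still be summable, and AM-GM with this weight must bound the increment itself by D plus a
    geometric term.\<close>
  define D where "D n x = 2 ^ n * (cmod (u (Suc n) x - u n x))\<^sup>2" for n x
  have Dint: "integrable lborel (D n)" for n
    unfolding D_def using L2_integrable[OF L2_diff[OF u u]] by simp
  have Dval: "(\<integral>\<^sup>+x. ennreal (D n x) \<partial>lborel) \<le> ennreal ((1 / 2) ^ n)" for n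
  proof -
    have "(\<integral>\<^sup>+x. ennreal (D n x) \<partial>lborel) = ennreal (LINT x|lborel. D n x)"
      by (rule nn_integral_eq_integral[OF Dint]) (simp add: D_def)
    also have "(LINT x|lborel. D n x) = 2 ^ n * (l2norm (\<lambda>x. u (Suc n) x - u n x))\<^sup>2"
      by (simp add: D_def l2norm_power2)
    also have "\<dots> \<le> 2 ^ n * ((1 / 2) ^ n)\<^sup>2"
      by (intro mult_left_mono power_mono d) auto
    also have "\<dots> = (1 / 2) ^ n"
      by (simp add: power2_eq_square power_divide)
    finally show ?thesis by (simp add: ennreal_leI)
  qed
  have "(\<integral>\<^sup>+x. (\<Sum>n. ennreal (D n x)) \<partial>lborel) = (\<Sum>n. \<integral>\<^sup>+x. ennreal (D n x) \<partial>lborel)"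
    by (rule nn_integral_suminf) (simp add: D_def)
  also have "\<dots> \<le> (\<Sum>n. ennreal ((1 / 2) ^ n))"
    by (intro suminf_le Dval) auto
  also have "(\<Sum>n. ennreal ((1 / 2) ^ n)) = ennreal (\<Sum>n. (1 / 2) ^ n)"
    by (rule suminf_ennreal2) (auto intro: summable_geometric)
  also have "\<dots> < \<infinity>"
    by (simp only: infinity_ennreal_def ennreal_less_top)
  finally have "AE x in lborel. (\<Sum>n. ennreal (D n x)) \<noteq> \<infinity>"
    by (intro nn_integral_PInf_AE) (simp_all add: D_def)
  then have conv: "AE x in lborel. convergent (\<lambda>n. u n x)"
  proof eventually_elim
    case (elim x)
    have sD: "summable (\<lambda>n. D n x)"
      using elim by (intro summable_suminf_not_top) (auto simp: D_def)
    have "summable (\<lambda>n. u (Suc n) x - u n x)"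
    proof (rule summable_comparison_test')
      show "summable (\<lambda>n. (1 / 2) ^ n + D n x)"
        by (intro summable_add sD summable_geometric) simp
      fix n
      have "cmod (u (Suc n) x - u n x) * 1 \<le> (2 * 2 ^ n) / 2 * (cmod (u (Suc n) x - u n x))\<^sup>2 + 1 / (2 * (2 * 2 ^ n)) * 1\<^sup>2"
        by (rule weighted_am_gm) simp
      also have "\<dots> \<le> (1 / 2) ^ n + D n x"
        by (simp add: D_def power_divide divide_simps)
      finally show "norm (u (Suc n) x - u n x) \<le> (1 / 2) ^ n + D n x" by simp
    qed
    then have "convergent (\<lambda>n. \<Sum>i<n. u (Suc i) x - u i x)"
      by (simp add: summable_iff_convergent)
    then have "convergent (\<lambda>n. u n x - u 0 x)"
      by (simp only: sum_lessThan_telescope[of "\<lambda>n. u n x"])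
    from convergent_add[OF this convergent_const[of "u 0 x"]] show ?case
      by simp
  qed
  define g where "g x = lim (\<lambda>n. u n x)" for x
  have g [measurable]: "g \<in> borel_measurable borel"
    unfolding g_def by measurable
  have lim: "AE x in lborel. (\<lambda>n. u n x) \<longlonglongrightarrow> g x"
    using conv by eventually_elim (simp add: g_def convergent_LIMSEQ_iff)
  have tel: "l2norm (\<lambda>x. u (n + k) x - u n x) \<le> (1 / 2) ^ n * (\<Sum>j<k. (1 / 2) ^ j)" for n k
  proof (induction k)
    case 0
    then show ?case by (simp add: l2norm_def)
  next
    case (Suc k)
    have "l2norm (\<lambda>x. u (n + Suc k) x - u n x)
        \<le> l2norm (\<lambda>x. u (Suc (n + k)) x - u (n + k) x) + l2norm (\<lambda>x. u (n + k) x - u n x)"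
      using l2norm_triangle_diff[OF u u u] by simp
    also have "\<dots> \<le> (1 / 2) ^ (n + k) + (1 / 2) ^ n * (\<Sum>j<k. (1 / 2) ^ j)"
      using d Suc by (intro add_mono)
    finally show ?case by (simp add: power_add algebra_simps)
  qed
  have geo: "(\<Sum>j<k. (1 / 2 :: real) ^ j) \<le> 2" for k
    using sum_le_suminf[OF summable_geometric[of "1/2::real"], of "{..<k}"] suminf_geometric[of "1/2::real"] by simp
  have Cauchy: "l2norm (\<lambda>x. u (n + k) x - u n x) \<le> 2 * (1 / 2) ^ n" for n k
    using order_trans[OF tel mult_left_mono[OF geo, of "(1/2) ^ n"]] by (simp add: mult.commute)
  \<comment> \<open>Fatou in k at fixed n turns the uniform Cauchy bound into a bound on the
    distance to the limit.\<close>
  have F: "(\<lambda>x. g x - u n x) \<in> L2" "l2norm (\<lambda>x. g x - u n x) \<le> 2 * (1 / 2) ^ n" for n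
  proof -
    have "AE x in lborel. (\<lambda>k. u (n + k) x - u n x) \<longlonglongrightarrow> g x - u n x"
      using lim
    proof eventually_elim
      case (elim x)
      then show ?case
        using tendsto_diff[OF LIMSEQ_ignore_initial_segment[OF elim, of n] tendsto_const[of "u n x"]]
        by (simp only: add.commute[of n])
    qed
    note F = L2_Fatou[of "\<lambda>k x. u (n + k) x - u n x", OF L2_diff[OF u u] _ this Cauchy]
    show "(\<lambda>x. g x - u n x) \<in> L2" "l2norm (\<lambda>x. g x - u n x) \<le> 2 * (1 / 2) ^ n"
      by (rule F; simp)+
  qed
  have gL2: "g \<in> L2"
    using L2_add[OF F(1)[of 0] u[of 0]] by simp
  have "(\<lambda>n. l2norm (\<lambda>x. u n x - g x)) \<longlonglongrightarrow> 0"
  proof (rule Lim_null_comparison)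
    show "(\<lambda>n. 2 * (1 / 2) ^ n) \<longlonglongrightarrow> (0::real)"
      using tendsto_mult[OF tendsto_const[of 2] LIMSEQ_power_zero[of "1/2::real"]] by simp
    show "\<forall>\<^sub>F n in sequentially. norm (l2norm (\<lambda>x. u n x - g x)) \<le> 2 * (1 / 2) ^ n"
      using F(2) by (simp add: l2norm_minus_commute[of "u n" g for n])
  qed
  with gL2 show ?thesis by blast
qed

text \<open>Truncating in height and in space reduces the claim to continuous functions that converge
  pointwise almost everywhere.\<close>

lemma L2_continuous_dense:
  fixes g :: "'a::euclidean_space \<Rightarrow> complex"
  assumes g: "g \<in> L2" and e: "0 < e"
  shows "\<exists>w. continuous_on UNIV w \<and> bounded (range w) \<and> integrable lborel w \<and> w \<in> L2 \<and>
    l2norm (\<lambda>x. w x - g x) < e"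
proof -
  have [measurable]: "g \<in> borel_measurable borel" using g by (rule L2_measurable)
  \<comment> \<open>\<open>clip R\<close> retracts the plane radially onto the disc of radius R;
    \<open>cut R\<close> is 1 on the ball of radius R and 0 outside the ball of radius R + 1. Both
    are continuous, so truncating a continuous approximant leaves it continuous.\<close>
  define clip where "clip R z = complex_of_real (R / max R (cmod z)) * z" for R :: real and z
  define cut where "cut R x = complex_of_real (max 0 (min 1 (R + 1 - norm x)))" for R :: real and x :: 'a
  have clip_bound: "cmod (clip R z) \<le> R" "cmod (clip R z) \<le> cmod z" if "0 < R" for R z
    using that by (auto simp: clip_def norm_mult norm_divide divide_simps max_def mult_right_mono)
  have clip_id: "clip R z = z" if "0 < R" "cmod z \<le> R" for R z
    using that by (simp add: clip_def max_def)
  have clip_cont: "continuous_on UNIV (clip R)" if "0 < R" for R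
    unfolding clip_def using that by (intro continuous_intros) (auto simp: max_def)
  have cut_bound: "cmod (cut R x) \<le> 1" "cmod (cut R x) \<le> indicator (cball 0 (R + 1)) x" for R x
    by (auto simp: cut_def indicator_def)
  have cut_id: "cut R x = 1" if "norm x \<le> R" for R x
    using that by (simp add: cut_def)
  have cut_cont: "continuous_on UNIV (cut R)" for R
    unfolding cut_def by (intro continuous_intros)
  have clip_meas: "clip R \<in> borel_measurable borel" if "0 < R" for R
    using clip_cont[OF that] by (rule borel_measurable_continuous_onI)
  have [measurable]: "cut R \<in> borel_measurable borel" for R
    using cut_cont by (rule borel_measurable_continuous_onI)
  have "g \<in> borel_measurable lebesgue"
    using g by (simp add: L2_measurable measurable_completion)
  \<comment> \<open>\<open>measurable_on\<close> means being a limit of continuous functions off a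
    negligible set, which is the source of the approximants \<open>h\<close>.\<close>
  then have "g measurable_on UNIV"
    by (intro lebesgue_measurable_imp_measurable_on) auto
  then obtain N h where N: "negligible N" and h: "\<And>n::nat. continuous_on UNIV (h n)"
    and hlim: "\<And>x. x \<notin> N \<Longrightarrow> (\<lambda>n. h n x) \<longlonglongrightarrow> g x"
    by (auto simp: measurable_on_def)
  have [measurable]: "h n \<in> borel_measurable borel" for n
    using h by (rule borel_measurable_continuous_onI)
  have "AE x in lebesgue. x \<notin> N"
    using N by (intro AE_not_in) (simp add: negligible_iff_null_sets)
  then have AEN: "AE x in lborel. x \<notin> N"
    by (simp add: AE_completion_iff)
  define G where "G n x = cut (real n + 1) x * clip (real n + 1) (g x)" for n x
  have G_meas [measurable]: "G n \<in> borel_measurable borel" for n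
  proof -
    have "(\<lambda>x. clip (real n + 1) (g x)) \<in> borel_measurable borel"
      by (rule measurable_compose[of g borel borel]) (auto intro: clip_meas)
    then show ?thesis unfolding G_def by measurable
  qed
  have Gb: "cmod (G n x) \<le> cmod (g x)" for n x
    using mult_mono[OF cut_bound(1)[of "real n + 1" x] clip_bound(2)[of "real n + 1" "g x"]]
    by (simp add: G_def norm_mult)
  have GL2: "G n \<in> L2" for n
    by (rule L2_dominated[OF _ L2_integrable[OF g]]) (use Gb in \<open>auto intro!: AE_I2 power_mono\<close>)
  have "(\<lambda>n. l2norm (\<lambda>x. G n x - g x)) \<longlonglongrightarrow> 0"
  proof (rule L2_dominated_convergence[OF _ _ L2_integrable[OF g]])
    show "AE x in lborel. (\<lambda>n. G n x) \<longlonglongrightarrow> g x"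
    proof (intro AE_I2 tendsto_eventually)
      fix x
      have "\<forall>\<^sub>F n in sequentially. norm x + cmod (g x) \<le> real n"
        by (rule eventually_ge_at_top[of "nat \<lceil>norm x + cmod (g x)\<rceil>", THEN eventually_mono]) linarith
      then show "\<forall>\<^sub>F n in sequentially. G n x = g x"
      proof eventually_elim
        case (elim n)
        then have "norm x \<le> real n + 1" "cmod (g x) \<le> real n + 1"
          using norm_ge_zero[of x] norm_ge_zero[of "g x"] by linarith+
        then show ?case by (simp add: G_def cut_id clip_id)
      qed
    qed
  qed (use Gb in auto)
  then obtain n where n: "l2norm (\<lambda>x. G n x - g x) < e / 2"
    using order_tendstoD(2)[of _ 0 sequentially "e / 2"] e
    by (auto simp: eventually_sequentially)
  define R where "R = real n + 1"
  have R: "0 < R" by (simp add: R_def)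
  \<comment> \<open>The approximants receive the same truncation as g. This yields a majorant R on a
    fixed ball, uniform in k, which the \<open>h k\<close> themselves need not have.\<close>
  define W where "W k x = cut R x * clip R (h k x)" for k x
  have Wc: "continuous_on UNIV (W k)" for k
    unfolding W_def
    by (intro continuous_intros cut_cont continuous_on_compose2[OF clip_cont[OF R] h]) auto
  have [measurable]: "W k \<in> borel_measurable borel" for k
    using Wc by (rule borel_measurable_continuous_onI)
  have Wb: "cmod (W k x) \<le> R * indicator (cball 0 (R + 1)) x" for k x
    using mult_mono[OF cut_bound(2)[of R x] clip_bound(1)[OF R, of "h k x"]] R
    by (simp add: W_def norm_mult mult.commute)
  have Wbd: "bounded (range (W k))" for k
  proof -
    have "cmod (W k x) \<le> R" for x
      using order_trans[OF Wb[of k x]] R by (auto simp: indicator_def)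
    then show ?thesis by (auto simp: bounded_iff)
  qed
  have ball: "integrable lborel (\<lambda>x::'a. R * indicator (cball 0 (R + 1)) x)"
    by (intro integrable_mult_right integrable_real_indicator) (auto intro: emeasure_bounded_finite[unfolded infinity_ennreal_def])
  have Wint: "integrable lborel (W k)" for k
    by (rule Bochner_Integration.integrable_bound[OF ball]) (use Wb[of k] R in \<open>auto intro!: AE_I2\<close>)
  have ball2: "integrable lborel (\<lambda>x::'a. (R * indicator (cball 0 (R + 1)) x)\<^sup>2)"
  proof -
    have "(\<lambda>x::'a. (R * indicator (cball 0 (R + 1)) x)\<^sup>2) = (\<lambda>x. R * (R * indicator (cball 0 (R + 1)) x))"
      by (auto simp: power2_eq_square indicator_def)
    then show ?thesis using ball by simp
  qed
  have WL2: "W k \<in> L2" for k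
    by (rule L2_dominated[OF _ ball2]) (use Wb[of k] in \<open>auto intro!: AE_I2 power_mono\<close>)
  have "(\<lambda>k. l2norm (\<lambda>x. W k x - G n x)) \<longlonglongrightarrow> 0"
  proof (rule L2_dominated_convergence[OF _ _ ball2])
    show "AE x in lborel. (\<lambda>k. W k x) \<longlonglongrightarrow> G n x"
      using AEN
    proof eventually_elim
      case (elim x)
      have "isCont (clip R) (g x)"
        using clip_cont[OF R] by (simp add: continuous_on_eq_continuous_at)
      then show ?case
        unfolding W_def G_def R_def[symmetric]
        by (rule tendsto_mult[OF tendsto_const isCont_tendsto_compose[OF _ hlim[OF elim]]])
    qed
  qed (use Wb in auto)
  then obtain k where k: "l2norm (\<lambda>x. W k x - G n x) < e / 2"
    using order_tendstoD(2)[of _ 0 sequentially "e / 2"] e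
    by (auto simp: eventually_sequentially)
  have "l2norm (\<lambda>x. W k x - g x) < e"
    using l2norm_triangle_diff[OF WL2 g GL2, of k n] n k by linarith
  then show ?thesis using Wc Wbd Wint WL2 by blast
qed

section \<open>The heat kernel\<close>

text \<open>Lebesgue measure is the image of the product measure over the coordinates. This reduces
  Gaussian integrals to one dimension.\<close>

lemma lborel_prod_Basis:
  fixes f :: "'a::euclidean_space \<Rightarrow> real \<Rightarrow> complex"
  assumes f: "\<And>b. b \<in> Basis \<Longrightarrow> integrable lborel (f b)"
  shows "integrable lborel (\<lambda>y::'a. \<Prod>b\<in>Basis. f b (y \<bullet> b))"
    and "(LINT y|lborel. (\<Prod>b\<in>Basis. f b (y \<bullet> b))) = (\<Prod>b\<in>Basis. LINT s|lborel. f b s)"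
proof -
  interpret product_sigma_finite "\<lambda>b::'a. lborel :: real measure" ..
  have [measurable]: "f b \<in> borel_measurable borel" if "b \<in> Basis" for b
    using f[OF that] by auto
  have meas [measurable]: "(\<lambda>y::'a. \<Prod>b\<in>Basis. f b (y \<bullet> b)) \<in> borel_measurable borel"
    by measurable
  have [measurable]: "(\<lambda>g. \<Sum>b\<in>Basis. g b *\<^sub>R b) \<in> measurable (Pi\<^sub>M Basis (\<lambda>b::'a. lborel)) (borel :: 'a measure)"
    by measurable
  have eq: "(\<Prod>b\<in>Basis. f b ((\<Sum>b\<in>Basis. g b *\<^sub>R b) \<bullet> b)) = (\<Prod>b\<in>Basis. f b (g b))" for g
    by (intro prod.cong refl) simp
  have int: "integrable (Pi\<^sub>M Basis (\<lambda>b::'a. lborel)) (\<lambda>g. \<Prod>b\<in>Basis. f b (g b))"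
    by (intro product_integrable_prod f) auto
  show "integrable lborel (\<lambda>y::'a. \<Prod>b\<in>Basis. f b (y \<bullet> b))"
    by (subst lborel_eq, subst integrable_distr_eq) (use int in \<open>simp_all add: eq\<close>)
  show "(LINT y|lborel. (\<Prod>b\<in>Basis. f b (y \<bullet> b))) = (\<Prod>b\<in>Basis. LINT s|lborel. f b s)"
    by (subst lborel_eq, subst integral_distr)
      (use product_integral_prod[OF finite_Basis, of f] f in \<open>simp_all add: eq\<close>)
qed

text \<open>The substitution with c = sqrt(2 t) turns the Gaussian into a multiple of the standard
  normal density, whose characteristic function is known.\<close>

lemma gaussian_fourier_real:
  fixes t x :: real
  assumes t: "0 < t"
  shows "integrable lborel (\<lambda>y. complex_of_real (exp (- t * y\<^sup>2)) * cis (- (y * x)))"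
    and "(LINT y|lborel. complex_of_real (exp (- t * y\<^sup>2)) * cis (- (y * x)))
      = complex_of_real (sqrt (pi / t) * exp (- x\<^sup>2 / (4 * t)))"
proof -
  define c where "c = sqrt (2 * t)"
  have c: "0 < c" "c\<^sup>2 = 2 * t" using t by (auto simp: c_def)
  define F where "F y = complex_of_real (std_normal_density y) * cis (- (x / c) * y)" for y
  have Fint: "integrable lborel F"
  proof (rule Bochner_Integration.integrable_bound)
    show "integrable lborel std_normal_density"
      by (rule integrable_normal_density) simp
    show "F \<in> borel_measurable lborel"
      unfolding F_def cis_conv_exp by measurable
  qed (simp add: F_def norm_mult)
  have Fval: "(LINT y|lborel. F y) = complex_of_real (exp (- x\<^sup>2 / (4 * t)))"
  proof -
    have "(LINT y|lborel. F y) = char std_normal_distribution (- (x / c))"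
      unfolding char_def F_def
      by (subst integral_density) (auto simp: scaleR_conv_of_real cis_conv_exp)
    also have "\<dots> = complex_of_real (exp (- x\<^sup>2 / (4 * t)))"
      by (simp add: char_std_normal_distribution power_divide c)
    finally show ?thesis .
  qed
  have Fc: "complex_of_real (exp (- t * y\<^sup>2)) * cis (- (y * x)) = complex_of_real (sqrt (2 * pi)) * F (0 + c * y)" for y
    using c t by (simp add: F_def std_normal_density_def power_mult_distrib mult.commute)
  show "integrable lborel (\<lambda>y. complex_of_real (exp (- t * y\<^sup>2)) * cis (- (y * x)))"
    unfolding Fc using lborel_integrable_real_affine[OF Fint, of c 0] c by simp
  have "complex_of_real (exp (- x\<^sup>2 / (4 * t))) = c *\<^sub>R (LINT y|lborel. F (0 + c * y))"
    using lborel_integral_real_affine[of c F 0] c Fval by simp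
  then have "(LINT y|lborel. F (0 + c * y)) = complex_of_real (exp (- x\<^sup>2 / (4 * t)) / c)"
    using c by (simp add: scaleR_conv_of_real field_simps)
  then have "(LINT y|lborel. complex_of_real (exp (- t * y\<^sup>2)) * cis (- (y * x)))
      = complex_of_real (sqrt (2 * pi) * (exp (- x\<^sup>2 / (4 * t)) / c))"
    unfolding Fc by simp
  also have "sqrt (2 * pi) * (exp (- x\<^sup>2 / (4 * t)) / c) = sqrt (pi / t) * exp (- x\<^sup>2 / (4 * t))"
    using t by (simp add: c_def real_sqrt_mult real_sqrt_divide)
  finally show "(LINT y|lborel. complex_of_real (exp (- t * y\<^sup>2)) * cis (- (y * x)))
      = complex_of_real (sqrt (pi / t) * exp (- x\<^sup>2 / (4 * t)))" .
qed

text \<open>The convolution kernel of P_t = exp(t Laplacian): a normal density with variance 2 t in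
  each coordinate, so that its multiplier is exp(-t |y|^2) with no factor 1/2.\<close>

definition heat_kernel :: "real \<Rightarrow> 'a::euclidean_space \<Rightarrow> real" where
  "heat_kernel t x = (4 * pi * t) powr (- (real DIM('a) / 2)) * exp (- (norm x)\<^sup>2 / (4 * t))"

lemma heat_kernel_pos: "0 < t \<Longrightarrow> 0 < heat_kernel t x"
  by (simp add: heat_kernel_def)

lemma heat_kernel_nonneg [simp]: "0 \<le> heat_kernel t x"
  by (simp add: heat_kernel_def)

lemma heat_kernel_measurable [measurable]: "heat_kernel t \<in> borel_measurable borel"
  unfolding heat_kernel_def by measurable

lemma norm_power2_Basis: "(norm (x::'a::euclidean_space))\<^sup>2 = (\<Sum>b\<in>Basis. (x \<bullet> b)\<^sup>2)"
  unfolding power2_norm_eq_inner by (subst euclidean_inner) (simp add: power2_eq_square)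

text \<open>The exponential of the coordinate sum is a product of one-dimensional integrands. The
  integral is unnormalised, hence the factor (2 pi)^d; it cancels later against the normalisation of
  \<open>fourier\<close>.\<close>

lemma gaussian_fourier:
  fixes x :: "'a::euclidean_space"
  assumes t: "0 < t"
  shows "integrable lborel (\<lambda>y::'a. complex_of_real (exp (- t * (norm y)\<^sup>2)) * cis (- (y \<bullet> x)))"
    and "(LINT y|lborel. complex_of_real (exp (- t * (norm y)\<^sup>2)) * cis (- (y \<bullet> x)))
      = complex_of_real ((2 * pi) ^ DIM('a) * heat_kernel t x)"
proof -
  have eq: "complex_of_real (exp (- t * (norm y)\<^sup>2)) * cis (- (y \<bullet> x))
      = (\<Prod>b\<in>Basis. complex_of_real (exp (- t * (y \<bullet> b)\<^sup>2)) * cis (- ((y \<bullet> b) * (x \<bullet> b))))" for y :: 'a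
  proof -
    have "complex_of_real (exp (- t * (norm y)\<^sup>2)) * cis (- (y \<bullet> x))
        = exp (complex_of_real (- t * (norm y)\<^sup>2) + \<i> * complex_of_real (- (y \<bullet> x)))"
      by (simp only: cis_conv_exp exp_add exp_of_real)
    also have "complex_of_real (- t * (norm y)\<^sup>2) + \<i> * complex_of_real (- (y \<bullet> x))
        = (\<Sum>b\<in>Basis. complex_of_real (- t * (y \<bullet> b)\<^sup>2) + \<i> * complex_of_real (- ((y \<bullet> b) * (x \<bullet> b))))"
      unfolding norm_power2_Basis euclidean_inner[of y x]
      by (simp add: sum.distrib sum_distrib_left sum_negf sum_subtractf)
    also have "exp \<dots> = (\<Prod>b\<in>Basis. complex_of_real (exp (- t * (y \<bullet> b)\<^sup>2)) * cis (- ((y \<bullet> b) * (x \<bullet> b))))"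
      by (simp only: exp_sum[OF finite_Basis] cis_conv_exp exp_add exp_of_real)
    finally show ?thesis .
  qed
  show "integrable lborel (\<lambda>y::'a. complex_of_real (exp (- t * (norm y)\<^sup>2)) * cis (- (y \<bullet> x)))"
    unfolding eq by (intro lborel_prod_Basis(1) gaussian_fourier_real(1) t)
  have "(LINT y|lborel. complex_of_real (exp (- t * (norm y)\<^sup>2)) * cis (- (y \<bullet> x)))
      = (\<Prod>b\<in>(Basis::'a set). complex_of_real (sqrt (pi / t) * exp (- (x \<bullet> b)\<^sup>2 / (4 * t))))"
    unfolding eq
    by (subst lborel_prod_Basis(2), rule gaussian_fourier_real(1)[OF t])
      (rule prod.cong[OF refl gaussian_fourier_real(2)[OF t]])
  also have "\<dots> = complex_of_real (sqrt (pi / t) ^ DIM('a) * exp (- (norm x)\<^sup>2 / (4 * t)))"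
  proof -
    have "(\<Prod>b\<in>Basis. exp (- (x \<bullet> b)\<^sup>2 / (4 * t))) = exp (- (norm x)\<^sup>2 / (4 * t))"
      by (simp add: norm_power2_Basis sum_divide_distrib flip: exp_sum sum_negf)
    then show ?thesis
      by (simp only: prod.distrib prod_constant of_real_prod[symmetric])
  qed
  also have "sqrt (pi / t) ^ DIM('a) = (2 * pi) ^ DIM('a) * (4 * pi * t) powr (- (real DIM('a) / 2))"
  proof -
    have "sqrt (pi / t) = 2 * pi * (4 * pi * t) powr (- (1 / 2))"
      using t by (simp add: powr_minus powr_half_sqrt real_sqrt_mult real_sqrt_divide field_simps)
    then have "sqrt (pi / t) ^ DIM('a) = (2 * pi) ^ DIM('a) * ((4 * pi * t) powr (- (1 / 2))) ^ DIM('a)"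
      by (simp add: power_mult_distrib)
    also have "((4 * pi * t) powr (- (1 / 2))) ^ DIM('a) = (4 * pi * t) powr (- (real DIM('a) / 2))"
      using t by (simp add: powr_powr flip: powr_realpow)
    finally show ?thesis .
  qed
  finally show "(LINT y|lborel. complex_of_real (exp (- t * (norm y)\<^sup>2)) * cis (- (y \<bullet> x)))
      = complex_of_real ((2 * pi) ^ DIM('a) * heat_kernel t x)"
    by (simp add: heat_kernel_def)
qed

lemma gaussian_integral:
  assumes t: "0 < t"
  shows "integrable lborel (\<lambda>y::'a::euclidean_space. exp (- t * (norm y)\<^sup>2))"
    and "(LINT y|lborel. exp (- t * (norm (y::'a::euclidean_space))\<^sup>2)) = (2 * pi) ^ DIM('a) * (4 * pi * t) powr (- (real DIM('a) / 2))"
proof -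
  have *: "integrable lborel (\<lambda>y::'a. complex_of_real (exp (- t * (norm y)\<^sup>2)))"
    using gaussian_fourier(1)[OF t, of "0::'a"] by simp
  then show int: "integrable lborel (\<lambda>y::'a. exp (- t * (norm y)\<^sup>2))"
    by (simp only: complex_of_real_integrable_eq)
  have "complex_of_real (LINT y|lborel. exp (- t * (norm (y::'a))\<^sup>2)) = complex_of_real ((2 * pi) ^ DIM('a) * (4 * pi * t) powr (- (real DIM('a) / 2)))"
    using gaussian_fourier(2)[OF t, of "0::'a"] by (simp add: heat_kernel_def)
  then show "(LINT y|lborel. exp (- t * (norm (y::'a::euclidean_space))\<^sup>2)) = (2 * pi) ^ DIM('a) * (4 * pi * t) powr (- (real DIM('a) / 2))"
    by (simp only: of_real_eq_iff)
qed

lemma heat_kernel_integral: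
  assumes t: "0 < t"
  shows "integrable lborel (heat_kernel t :: 'a::euclidean_space \<Rightarrow> real)"
    and "(LINT x|lborel. heat_kernel t (x::'a)) = 1"
proof -
  have eq: "heat_kernel t x = (4 * pi * t) powr (- (real DIM('a) / 2)) * exp (- (1 / (4 * t)) * (norm x)\<^sup>2)" for x :: 'a
    by (simp add: heat_kernel_def)
  \<comment> \<open>In x the kernel is again a Gaussian exp(-s |x|^2), with s = 1 / (4 t); the
    integral formula is applied at this parameter.\<close>
  have t': "0 < 1 / (4 * t)" using t by simp
  show "integrable lborel (heat_kernel t :: 'a \<Rightarrow> real)"
    using gaussian_integral(1)[OF t', where 'a='a] unfolding eq[abs_def] by (intro integrable_mult_right) 
  have "(LINT x|lborel. heat_kernel t (x::'a)) = (4 * pi * t) powr (- (real DIM('a) / 2)) *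
      ((2 * pi) ^ DIM('a) * (4 * pi * (1 / (4 * t))) powr (- (real DIM('a) / 2)))"
    unfolding eq[abs_def] using gaussian_integral(2)[OF t', where 'a='a] by simp
  also have "(4 * pi * t) powr (- (real DIM('a) / 2)) * ((2 * pi) ^ DIM('a) * (4 * pi * (1 / (4 * t))) powr (- (real DIM('a) / 2)))
     = (2 * pi) ^ DIM('a) * ((2 * pi) ^ 2) powr (- (real DIM('a) / 2))"
    using t by (simp add: power2_eq_square powr_mult[symmetric])
  also have "\<dots> = 1"
  proof -
    have "((2 * pi) ^ 2) powr (- (real DIM('a) / 2)) = (2 * pi) powr (- real DIM('a))"
      by (subst powr_realpow[symmetric]) (simp_all only: powr_powr, simp_all)
    then show ?thesis by (simp add: powr_minus powr_realpow field_simps)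
  qed
  finally show "(LINT x|lborel. heat_kernel t (x::'a)) = 1" .
qed

section \<open>Fubini's theorem with \<open>lborel\<close> on the product type in place of the pair
  measure\<close>

lemma lborel_Fubini_integrable:
  fixes f :: "'a::euclidean_space \<times> 'b::euclidean_space \<Rightarrow> 'c::{banach, second_countable_topology}"
  assumes "f \<in> borel_measurable borel" "integrable lborel (\<lambda>x. LINT y|lborel. norm (f (x, y)))"
    and "AE x in lborel. integrable lborel (\<lambda>y. f (x, y))"
  shows "integrable lborel f"
  unfolding lborel_prod[symmetric]
  by (rule lborel_pair.Fubini_integrable) (use assms in \<open>simp_all add: lborel_prod\<close>)

lemma lborel_integral_fst:
  fixes f :: "'a::euclidean_space \<times> 'b::euclidean_space \<Rightarrow> 'c::{banach, second_countable_topology}"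
  assumes "integrable lborel f"
  shows "(LINT x|lborel. LINT y|lborel. f (x, y)) = (LINT p|lborel. f p)"
  using lborel_pair.integral_fst'[of f] assms by (simp add: lborel_prod)

lemma lborel_integral_snd:
  fixes f :: "'a::euclidean_space \<times> 'b::euclidean_space \<Rightarrow> 'c::{banach, second_countable_topology}"
  assumes "integrable lborel f"
  shows "(LINT y|lborel. LINT x|lborel. f (x, y)) = (LINT p|lborel. f p)"
  using lborel_pair.integral_snd[of "\<lambda>x y. f (x, y)"] assms by (simp add: lborel_prod)

lemma
  fixes f :: "'a::euclidean_space \<times> 'b::euclidean_space \<Rightarrow> 'c::{banach, second_countable_topology}"
  shows lborel_integrable_swap: "integrable lborel f \<Longrightarrow> integrable lborel (\<lambda>p. f (snd p, fst p))"
    and lborel_integral_swap: "f \<in> borel_measurable borel \<Longrightarrow> (LINT p|lborel. f (snd p, fst p)) = (LINT p|lborel. f p)"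
  using lborel_pair.integrable_product_swap[of f] lborel_pair.integral_product_swap[of f]
  by (simp_all add: lborel_prod case_prod_unfold)

lemma lborel_prod_mult:
  fixes f :: "'a::euclidean_space \<Rightarrow> complex" and g :: "'b::euclidean_space \<Rightarrow> complex"
  assumes f: "integrable lborel f" and g: "integrable lborel g"
  shows "integrable lborel (\<lambda>p. f (fst p) * g (snd p))"
    and "(LINT p|lborel. f (fst p) * g (snd p)) = (LINT x|lborel. f x) * (LINT y|lborel. g y)"
proof -
  have [measurable]: "f \<in> borel_measurable borel" "g \<in> borel_measurable borel"
    using f g by auto
  show int: "integrable lborel (\<lambda>p. f (fst p) * g (snd p))"
    by (rule lborel_Fubini_integrable) (use f g in \<open>auto simp: norm_mult borel_prod[symmetric]\<close>)
  show "(LINT p|lborel. f (fst p) * g (snd p)) = (LINT x|lborel. f x) * (LINT y|lborel. g y)"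
    using lborel_integral_fst[OF int] by simp
qed

text \<open>The substitution x = z + sqrt(t) w moves all dependence on t from the kernel into the
  argument of f, so the limit t \<rightarrow> 0 can be taken under a fixed integrable
  weight.\<close>

lemma
  fixes f :: "'a::euclidean_space \<Rightarrow> 'b::{banach, second_countable_topology}" and t :: real
  assumes t: "0 < t" and [measurable]: "f \<in> borel_measurable borel"
  shows heat_kernel_integral_rescale:
      "(LINT x|lborel. heat_kernel t (x - z) *\<^sub>R f x) = (LINT w|lborel. heat_kernel 1 w *\<^sub>R f (z + sqrt t *\<^sub>R w))" (is ?A)
    and heat_kernel_integrable_rescale:
      "integrable lborel (\<lambda>x. heat_kernel t (x - z) *\<^sub>R f x) \<longleftrightarrow> integrable lborel (\<lambda>w. heat_kernel 1 w *\<^sub>R f (z + sqrt t *\<^sub>R w))" (is ?B)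
proof -
  have eq: "\<bar>sqrt t\<bar> ^ DIM('a) * heat_kernel t (sqrt t *\<^sub>R w) = heat_kernel 1 w" for w :: 'a
  proof -
    have "\<bar>sqrt t\<bar> ^ DIM('a) = t powr (real DIM('a) / 2)"
      using t by (simp add: powr_half_sqrt[symmetric] powr_powr flip: powr_realpow)
    then show ?thesis
      using t by (simp add: heat_kernel_def powr_mult power_mult_distrib powr_minus field_simps)
  qed
  have s: "sqrt t \<noteq> 0" using t by simp
  have *: "lborel = density (distr lborel borel (\<lambda>x. z + sqrt t *\<^sub>R x)) (\<lambda>_. ennreal (\<bar>sqrt t\<bar> ^ DIM('a)))"
    using lborel_affine[OF s, of z] by (simp add: ennreal_power)
  show ?A
    by (subst *, subst integral_density) (simp_all add: integral_distr eq)
  show ?B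
    by (subst *, subst integrable_density) (simp_all add: integrable_distr_eq eq)
qed

lemma heat_kernel_translate:
  assumes "0 < t"
  shows "integrable lborel (\<lambda>x::'a::euclidean_space. heat_kernel t (x - z))"
    and "(LINT x|lborel. heat_kernel t (x - z :: 'a)) = 1"
  using heat_kernel_integral[of 1, where 'a='a] heat_kernel_integral_rescale[OF assms, of "\<lambda>_. 1::real" z]
    heat_kernel_integrable_rescale[OF assms, of "\<lambda>_. 1::real" z]
  by simp_all

lemma heat_kernel_commute: "heat_kernel t (x - y) = heat_kernel t (y - x)"
  by (simp add: heat_kernel_def norm_minus_commute)

text \<open>The kernel has mass 1 in each variable separately, so the variable on which w does not
  depend integrates out. These are the two marginal bounds of a Schur test.\<close>

lemma heat_kernel_pair_integrable:
  fixes w :: "'a::euclidean_space \<Rightarrow> real"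
  assumes t: "0 < t" and w: "integrable lborel w"
  shows "integrable lborel (\<lambda>p. heat_kernel t (fst p - snd p) * w (fst p))"
    and "(LINT p|lborel. heat_kernel t (fst p - snd p) * w (fst p)) = (LINT x|lborel. w x)"
    and "integrable lborel (\<lambda>p. heat_kernel t (fst p - snd p) * w (snd p))"
    and "(LINT p|lborel. heat_kernel t (fst p - snd p) * w (snd p)) = (LINT x|lborel. w x)"
proof -
  have [measurable]: "w \<in> borel_measurable borel" using w by auto
  have k: "integrable lborel (\<lambda>y. heat_kernel t (x - y))" "(LINT y|lborel. heat_kernel t (x - y)) = 1" for x :: 'a
    using heat_kernel_translate[OF t, of x] by (simp_all add: heat_kernel_commute[of t x])
  show int: "integrable lborel (\<lambda>p. heat_kernel t (fst p - snd p) * w (fst p))"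
    by (rule lborel_Fubini_integrable) (use w k in \<open>auto simp: abs_mult borel_prod[symmetric]\<close>)
  show val: "(LINT p|lborel. heat_kernel t (fst p - snd p) * w (fst p)) = (LINT x|lborel. w x)"
    using lborel_integral_fst[OF int] k by simp
  show "integrable lborel (\<lambda>p. heat_kernel t (fst p - snd p) * w (snd p))"
    using lborel_integrable_swap[OF int] by (simp add: heat_kernel_commute)
  have "(\<lambda>p. heat_kernel t (fst p - snd p) * w (fst p)) \<in> borel_measurable borel"
    using int by auto
  from lborel_integral_swap[OF this] val
  show "(LINT p|lborel. heat_kernel t (fst p - snd p) * w (snd p)) = (LINT x|lborel. w x)"
    by (simp add: heat_kernel_commute)
qed

text \<open>This is <P_t f, g>, written as one integral over the product space so that Fubini and
  the measure-preserving swap and reflection apply to it directly.\<close>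

definition heat_form :: "real \<Rightarrow> ('a::euclidean_space \<Rightarrow> complex) \<Rightarrow> ('a \<Rightarrow> complex) \<Rightarrow> complex" where
  "heat_form t f g = (LINT p|lborel. complex_of_real (heat_kernel t (fst p - snd p)) * f (snd p) * cnj (g (fst p)))"

lemma heat_form_pointwise_bound:
  assumes "0 < c"
  shows "norm (complex_of_real (heat_kernel t (x - y)) * a * cnj b)
    \<le> heat_kernel t (x - y) * (c / 2 * (cmod a)\<^sup>2) + heat_kernel t (x - y) * (1 / (2 * c) * (cmod b)\<^sup>2)"
proof -
  have "norm (complex_of_real (heat_kernel t (x - y)) * a * cnj b) = heat_kernel t (x - y) * (cmod a * cmod b)"
    by (simp add: norm_mult)
  also have "\<dots> \<le> heat_kernel t (x - y) * (c / 2 * (cmod a)\<^sup>2 + 1 / (2 * c) * (cmod b)\<^sup>2)"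
    by (intro mult_left_mono weighted_am_gm assms) simp
  finally show ?thesis by (simp add: distrib_left)
qed

lemma heat_form_measurable:
  assumes "f \<in> borel_measurable borel" "g \<in> borel_measurable borel"
  shows "(\<lambda>p. complex_of_real (heat_kernel t (fst p - snd p)) * f (snd p) * cnj (g (fst p))) \<in> borel_measurable borel"
  using assms unfolding borel_prod[symmetric] by measurable

lemma heat_form_integrable:
  assumes t: "0 < t" and f: "f \<in> L2" and g: "g \<in> L2"
  shows "integrable lborel (\<lambda>p. complex_of_real (heat_kernel t (fst p - snd p)) * f (snd p) * cnj (g (fst p)))"
proof (rule Bochner_Integration.integrable_bound)
  show "integrable lborel (\<lambda>p. heat_kernel t (fst p - snd p) * (1 / 2 * (cmod (f (snd p)))\<^sup>2)
      + heat_kernel t (fst p - snd p) * (1 / (2 * 1) * (cmod (g (fst p)))\<^sup>2))"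
    using heat_kernel_pair_integrable(3)[OF t integrable_mult_right[OF L2_integrable[OF f], of "1/2"]]
      heat_kernel_pair_integrable(1)[OF t integrable_mult_right[OF L2_integrable[OF g], of "1/2"]]
    by (intro Bochner_Integration.integrable_add) simp_all
  show "AE p in lborel. norm (complex_of_real (heat_kernel t (fst p - snd p)) * f (snd p) * cnj (g (fst p)))
      \<le> norm (heat_kernel t (fst p - snd p) * (1 / 2 * (cmod (f (snd p)))\<^sup>2)
      + heat_kernel t (fst p - snd p) * (1 / (2 * 1) * (cmod (g (fst p)))\<^sup>2))"
    by (intro AE_I2) (rule order_trans[OF heat_form_pointwise_bound[where c=1]], auto)
  show "(\<lambda>p. complex_of_real (heat_kernel t (fst p - snd p)) * f (snd p) * cnj (g (fst p))) \<in> borel_measurable lborel"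
    using heat_form_measurable[OF L2_measurable[OF f] L2_measurable[OF g]] by simp
qed

text \<open>Contractivity of P_t by the Schur test: weighted AM-GM separates f from g, each half
  reduces to a marginal of mass 1, and the weight is optimised at the end.\<close>

lemma heat_form_bound:
  assumes t: "0 < t" and f: "f \<in> L2" and g: "g \<in> L2"
  shows "cmod (heat_form t f g) \<le> l2norm f * l2norm g"
proof (rule le_mult_if_le_weighted)
  fix c :: real assume c: "0 < c"
  note I1 = integrable_mult_right[OF L2_integrable[OF f], of "c / 2"]
  note I2 = integrable_mult_right[OF L2_integrable[OF g], of "1 / (2 * c)"]
  note J1 = heat_kernel_pair_integrable(3)[OF t I1]
  note J2 = heat_kernel_pair_integrable(1)[OF t I2]
  have "cmod (heat_form t f g)
      \<le> (LINT p|lborel. norm (complex_of_real (heat_kernel t (fst p - snd p)) * f (snd p) * cnj (g (fst p))))"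
    unfolding heat_form_def by (rule integral_norm_bound)
  also have "\<dots> \<le> (LINT p|lborel. heat_kernel t (fst p - snd p) * (c / 2 * (cmod (f (snd p)))\<^sup>2)
      + heat_kernel t (fst p - snd p) * (1 / (2 * c) * (cmod (g (fst p)))\<^sup>2))"
    by (intro integral_mono integrable_norm heat_form_integrable t f g
        Bochner_Integration.integrable_add J1 J2 heat_form_pointwise_bound c)
  also have "\<dots> = (LINT x|lborel. c / 2 * (cmod (f x))\<^sup>2) + (LINT x|lborel. 1 / (2 * c) * (cmod (g x))\<^sup>2)"
    by (subst Bochner_Integration.integral_add[OF J1 J2])
      (simp only: heat_kernel_pair_integrable(4)[OF t I1] heat_kernel_pair_integrable(2)[OF t I2])
  also have "\<dots> = c / 2 * (l2norm f)\<^sup>2 + 1 / (2 * c) * (l2norm g)\<^sup>2"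
    by (simp only: integral_mult_right_zero l2norm_power2)
  finally show "cmod (heat_form t f g) \<le> c / 2 * (l2norm f)\<^sup>2 + 1 / (2 * c) * (l2norm g)\<^sup>2" .
qed auto

lemma heat_form_diff:
  assumes t: "0 < t" and "f \<in> L2" "g \<in> L2" "h \<in> L2"
  shows "heat_form t (\<lambda>x. f x - g x) h = heat_form t f h - heat_form t g h"
    and "heat_form t h (\<lambda>x. f x - g x) = heat_form t h f - heat_form t h g"
  using heat_form_integrable[OF t assms(2,4)] heat_form_integrable[OF t assms(3,4)]
    heat_form_integrable[OF t assms(4,2)] heat_form_integrable[OF t assms(4,3)]
  by (simp_all add: heat_form_def algebra_simps)

lemma heat_form_tendsto:
  assumes "0 < t" "\<And>n. u n \<in> L2" "f \<in> L2" "(\<lambda>n. l2norm (\<lambda>x. u n x - f x)) \<longlonglongrightarrow> 0"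
    and "\<And>n. w n \<in> L2" "g \<in> L2" "(\<lambda>n. l2norm (\<lambda>x. w n x - g x)) \<longlonglongrightarrow> 0"
  shows "(\<lambda>n. heat_form t (u n) (w n)) \<longlonglongrightarrow> heat_form t f g"
  by (rule bounded_form_tendsto[where Q = "heat_form t"]) (use assms heat_form_diff heat_form_bound in auto)

text \<open>After rescaling, dominated convergence is applied twice: in w, where g is bounded and
  continuous and the kernel at time 1 is integrable, and then in z, where u is integrable.\<close>

lemma heat_form_initial:
  fixes u g :: "'a::euclidean_space \<Rightarrow> complex"
  assumes u: "integrable lborel u" and g: "continuous_on UNIV g" "bounded (range g)"
    and t: "\<And>n. 0 < t n" "t \<longlonglongrightarrow> 0"
  shows "(\<lambda>n. heat_form (t n) u g) \<longlonglongrightarrow> l2inner u g"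
proof -
  obtain B where B: "\<And>x. cmod (g x) \<le> B" using g(2) by (auto simp: bounded_iff)
  have [measurable]: "u \<in> borel_measurable borel" "g \<in> borel_measurable borel"
    using u g(1) by (auto intro: borel_measurable_continuous_onI)
  \<comment> \<open>\<open>P n\<close> is the heat semigroup at time \<open>t n\<close> applied to
    the conjugate of g, in rescaled form.\<close>
  define P where "P n z = (LINT w|lborel. heat_kernel 1 w *\<^sub>R cnj (g (z + sqrt (t n) *\<^sub>R w)))" for n z
  have kint: "integrable lborel (\<lambda>w::'a. heat_kernel 1 w * B)"
    using heat_kernel_integral(1)[of 1, where 'a='a] by simp
  have bound: "norm (heat_kernel 1 w *\<^sub>R cnj (g (z + sqrt (t n) *\<^sub>R w))) \<le> heat_kernel 1 w * B" for n w z
    using B by (simp add: mult_left_mono)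
  have "integrable lborel (\<lambda>w. heat_kernel 1 w *\<^sub>R cnj (g (z + sqrt (t n) *\<^sub>R w)))" for n z
    by (rule Bochner_Integration.integrable_bound[OF kint])
      (auto intro!: AE_I2 order_trans[OF bound] simp del: norm_scaleR)
  then have Pb: "norm (P n z) \<le> B" for n z
    unfolding P_def
    using order_trans[OF integral_norm_bound integral_mono[OF integrable_norm kint bound]]
      heat_kernel_integral(2)[of 1, where 'a='a] by simp
  have Pm: "P n \<in> borel_measurable borel" for n
    unfolding P_def by measurable
  have Plim: "(\<lambda>n. P n z) \<longlonglongrightarrow> cnj (g z)" for z
  proof -
    have "(\<lambda>n. P n z) \<longlonglongrightarrow> (LINT w|lborel. heat_kernel 1 (w::'a) *\<^sub>R cnj (g z))"
      unfolding P_def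
    proof (rule integral_dominated_convergence[OF _ _ kint])
      show "AE w in lborel. (\<lambda>n. heat_kernel 1 w *\<^sub>R cnj (g (z + sqrt (t n) *\<^sub>R w))) \<longlonglongrightarrow> heat_kernel 1 w *\<^sub>R cnj (g z)"
      proof (intro AE_I2 tendsto_intros)
        fix w
        have "(\<lambda>n. z + sqrt (t n) *\<^sub>R w) \<longlonglongrightarrow> z + sqrt 0 *\<^sub>R w"
          by (intro tendsto_intros t)
        then have "(\<lambda>n. z + sqrt (t n) *\<^sub>R w) \<longlonglongrightarrow> z" by simp
        then show "(\<lambda>n. g (z + sqrt (t n) *\<^sub>R w)) \<longlonglongrightarrow> g z"
          using g(1) by (intro isCont_tendsto_compose[of z g]) (auto simp: continuous_on_eq_continuous_at)
      qed
    qed (use bound in auto)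
    then show ?thesis using heat_kernel_integral[of 1, where 'a='a] by simp
  qed
  have eq: "heat_form (t n) u g = (LINT z|lborel. u z * P n z)" for n
  proof -
    have int: "integrable lborel (\<lambda>p. complex_of_real (heat_kernel (t n) (fst p - snd p)) * u (snd p) * cnj (g (fst p)))"
    proof (rule Bochner_Integration.integrable_bound)
      show "integrable lborel (\<lambda>p. heat_kernel (t n) (fst p - snd p) * (B * cmod (u (snd p))))"
        using u by (intro heat_kernel_pair_integrable(3)[OF t(1)]) simp
      show "AE p in lborel. norm (complex_of_real (heat_kernel (t n) (fst p - snd p)) * u (snd p) * cnj (g (fst p)))
        \<le> norm (heat_kernel (t n) (fst p - snd p) * (B * cmod (u (snd p))))"
      proof (intro AE_I2)
        fix p :: "'a \<times> 'a"
        have "0 \<le> B" using B[of 0] norm_ge_zero order_trans by blast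
        then show "norm (complex_of_real (heat_kernel (t n) (fst p - snd p)) * u (snd p) * cnj (g (fst p)))
          \<le> norm (heat_kernel (t n) (fst p - snd p) * (B * cmod (u (snd p))))"
          using B[of "fst p"] by (simp add: norm_mult mult.assoc mult.commute[of B] mult_left_mono)
      qed
    qed (simp add: heat_form_measurable)
    have "heat_form (t n) u g = (LINT z|lborel. LINT x|lborel. u z * (heat_kernel (t n) (x - z) *\<^sub>R cnj (g x)))"
      unfolding heat_form_def lborel_integral_snd[OF int, symmetric]
      by (simp add: scaleR_conv_of_real mult.assoc mult.left_commute)
    also have "\<dots> = (LINT z|lborel. u z * P n z)"
      unfolding P_def integral_mult_right_zero
      by (subst heat_kernel_integral_rescale[OF t(1)]) simp_all
    finally show ?thesis .
  qed
  show ?thesis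
    unfolding eq l2inner_def
  proof (rule integral_dominated_convergence)
    show "integrable lborel (\<lambda>x. B * cmod (u x))" using u by simp
    show "AE x in lborel. (\<lambda>n. u x * P n x) \<longlonglongrightarrow> u x * cnj (g x)"
      by (intro AE_I2 tendsto_intros Plim)
    show "AE x in lborel. norm (u x * P n x) \<le> B * cmod (u x)" for n
      using Pb[of n] by (intro AE_I2) (simp add: norm_mult mult.commute[of B] mult_left_mono)
  qed (use Pm in auto)
qed

section \<open>The Fourier-Plancherel transform\<close>

lemma cis_measurable [measurable (raw)]:
  "f \<in> borel_measurable M \<Longrightarrow> (\<lambda>x. cis (f x)) \<in> borel_measurable M"
  unfolding cis_conv_exp by measurable

lemma fourier_measurable [measurable]:
  fixes f :: "'a::euclidean_space \<Rightarrow> complex"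
  assumes [measurable]: "f \<in> borel_measurable borel"
  shows "fourier f \<in> borel_measurable borel"
  unfolding fourier_def[abs_def] by measurable

lemma cis_mult_integrable:
  fixes f :: "'a::euclidean_space \<Rightarrow> complex"
  assumes f: "integrable lborel f"
  shows "integrable lborel (\<lambda>x. cis (- (y \<bullet> x)) * f x)"
proof (rule Bochner_Integration.integrable_bound[OF f])
  show "(\<lambda>x. cis (- (y \<bullet> x)) * f x) \<in> borel_measurable lborel"
    using f by measurable
qed (simp add: norm_mult)

lemma fourier_diff:
  assumes "integrable lborel f" "integrable lborel g"
  shows "fourier (\<lambda>x. f x - g x) y = fourier f y - fourier g y"
  using cis_mult_integrable[OF assms(1), of y] cis_mult_integrable[OF assms(2), of y]
  by (simp add: fourier_def algebra_simps)

text \<open>The Gaussian makes the triple integral over one frequency and two positions absolutely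
  convergent. Integrating the positions first gives the two transforms, integrating the frequency
  first gives the kernel.\<close>

lemma fourier_heat_form:
  fixes u w :: "'a::euclidean_space \<Rightarrow> complex"
  assumes t: "0 < t" and u: "integrable lborel u" and w: "integrable lborel w"
  shows "(LINT y|lborel. complex_of_real (exp (- t * (norm y)\<^sup>2)) * (fourier u y * cnj (fourier w y))) = heat_form t u w"
proof -
  define F :: "'a \<times> ('a \<times> 'a) \<Rightarrow> complex" where
    "F q = complex_of_real (exp (- t * (norm (fst q))\<^sup>2)) *
      ((cnj (cis (- (fst q \<bullet> fst (snd q))) * w (fst (snd q)))) * (cis (- (fst q \<bullet> snd (snd q))) * u (snd (snd q))))" for q
  have [measurable]: "u \<in> borel_measurable borel" "w \<in> borel_measurable borel"
    using u w by auto
  have Fm: "F \<in> borel_measurable borel"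
    unfolding F_def borel_prod[symmetric] by measurable
  have Fint: "integrable lborel F"
  proof (rule Bochner_Integration.integrable_bound)
    have w': "integrable lborel (\<lambda>x. cnj (w x))" using w by simp
    have e: "integrable lborel (\<lambda>y::'a. complex_of_real (exp (- t * (norm y)\<^sup>2)))"
      using gaussian_fourier(1)[OF t, of "0::'a"] by simp
    show "integrable lborel (\<lambda>q::'a \<times> 'a \<times> 'a. complex_of_real (exp (- t * (norm (fst q))\<^sup>2)) * (cnj (w (fst (snd q))) * u (snd (snd q))))"
      using lborel_prod_mult(1)[OF e lborel_prod_mult(1)[OF w' u]] by simp
  qed (use Fm in \<open>auto simp: F_def norm_mult\<close>)
  have inner1: "(LINT p|lborel. F (y, p)) = (2 * pi) ^ DIM('a) *
      (complex_of_real (exp (- t * (norm y)\<^sup>2)) * (fourier u y * cnj (fourier w y)))" for y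
  proof -
    have "(LINT p|lborel. F (y, p)) = complex_of_real (exp (- t * (norm y)\<^sup>2)) *
        (LINT p|lborel. cnj (cis (- (y \<bullet> fst p)) * w (fst p)) * (cis (- (y \<bullet> snd p)) * u (snd p)))"
      unfolding F_def fst_conv snd_conv by (rule integral_mult_right_zero)
    also have "(LINT p|lborel. cnj (cis (- (y \<bullet> fst p)) * w (fst p)) * (cis (- (y \<bullet> snd p)) * u (snd p)))
        = (LINT x|lborel. cnj (cis (- (y \<bullet> x)) * w x)) * (LINT x|lborel. cis (- (y \<bullet> x)) * u x)"
      using cis_mult_integrable[OF w, of y]
      by (intro lborel_prod_mult(2) cis_mult_integrable u) (simp only: complex_integrable_cnj)
    also have "(LINT x|lborel. cnj (cis (- (y \<bullet> x)) * w x)) = cnj (LINT x|lborel. cis (- (y \<bullet> x)) * w x)"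
      by (rule Bochner_Integration.integral_cnj)
    finally have *: "(LINT p|lborel. F (y, p)) = complex_of_real (exp (- t * (norm y)\<^sup>2)) *
      (cnj (LINT x|lborel. cis (- (y \<bullet> x)) * w x) * (LINT x|lborel. cis (- (y \<bullet> x)) * u x))" .
    \<comment> \<open>The normalising factors of the two transforms cancel the (2 pi)^d coming from
      the Gaussian integral.\<close>
    have k: "(2 * pi) ^ DIM('a) * ((2 * pi) powr (- (real DIM('a) / 2)) * (2 * pi) powr (- (real DIM('a) / 2))) = 1"
    proof -
      have "(2 * pi) powr (- (real DIM('a) / 2)) * (2 * pi) powr (- (real DIM('a) / 2)) = (2 * pi) powr (- real DIM('a))"
        by (simp flip: powr_add)
      then show ?thesis by (simp add: powr_minus powr_realpow field_simps)
    qed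
    have "(2 * pi) ^ DIM('a) * (complex_of_real (exp (- t * (norm y)\<^sup>2)) * (fourier u y * cnj (fourier w y)))
      = complex_of_real ((2 * pi) ^ DIM('a) * ((2 * pi) powr (- (real DIM('a) / 2)) * (2 * pi) powr (- (real DIM('a) / 2)))) *
       (complex_of_real (exp (- t * (norm y)\<^sup>2)) *
        (cnj (LINT x|lborel. cis (- (y \<bullet> x)) * w x) * (LINT x|lborel. cis (- (y \<bullet> x)) * u x)))"
      by (simp only: fourier_def complex_cnj_mult complex_cnj_complex_of_real of_real_mult of_real_power
          of_real_numeral mult_ac)
    then show ?thesis unfolding k * by simp
  qed
  have inner2: "(LINT y|lborel. F (y, p)) = (2 * pi) ^ DIM('a) *
      (complex_of_real (heat_kernel t (fst p - snd p)) * u (snd p) * cnj (w (fst p)))" for p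
  proof -
    have "F (y, p) = complex_of_real (exp (- t * (norm y)\<^sup>2)) * cis (- (y \<bullet> (snd p - fst p))) * (u (snd p) * cnj (w (fst p)))" for y
    proof -
      have "cnj (cis (- (y \<bullet> fst p))) * cis (- (y \<bullet> snd p)) = cis (- (y \<bullet> (snd p - fst p)))"
        by (simp add: cis_cnj cis_mult inner_diff_right)
      then show ?thesis by (simp add: F_def mult_ac)
    qed
    then have "(LINT y|lborel. F (y, p)) = complex_of_real ((2 * pi) ^ DIM('a) * heat_kernel t (snd p - fst p)) * (u (snd p) * cnj (w (fst p)))"
      by (simp only: integral_mult_left_zero gaussian_fourier(2)[OF t])
    then show ?thesis by (simp add: heat_kernel_commute mult_ac)
  qed
  have "(LINT y|lborel. LINT p|lborel. F (y, p)) = (LINT p|lborel. LINT y|lborel. F (y, p))"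
    using lborel_integral_fst[OF Fint] lborel_integral_snd[OF Fint] by simp
  then show ?thesis
    unfolding inner1 inner2 heat_form_def integral_mult_right_zero by simp
qed

text \<open>The damped transform has squared norm \<open>heat_form t u u\<close>, hence norm at most
  that of u, and Fatou removes the damping. This inequality must precede Parseval: it supplies the
  integrable majorant needed there.\<close>

lemma fourier_L2_contraction:
  fixes u :: "'a::euclidean_space \<Rightarrow> complex"
  assumes u: "integrable lborel u" "u \<in> L2"
  shows "fourier u \<in> L2" and "l2norm (fourier u) \<le> l2norm u"
proof -
  have [measurable]: "u \<in> borel_measurable borel" using u by auto
  define c where "c = (2 * pi) powr (- (real DIM('a) / 2)) * (LINT x|lborel. cmod (u x))"
  have c: "cmod (fourier u y) \<le> c" for y
  proof -
    have "cmod (LINT x|lborel. cis (- (y \<bullet> x)) * u x) \<le> (LINT x|lborel. cmod (cis (- (y \<bullet> x)) * u x))"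
      by (rule integral_norm_bound)
    then show ?thesis
      unfolding fourier_def c_def by (simp add: norm_mult mult_left_mono)
  qed
  \<comment> \<open>The exponent carries a factor 1/2 so that the square of v is damped by exactly
    the heat multiplier at time 1 / (n + 1).\<close>
  define v where "v n y = complex_of_real (exp (- (1 / (2 * (real n + 1))) * (norm y)\<^sup>2)) * fourier u y" for n and y :: 'a
  have vsq: "(cmod (v n y))\<^sup>2 = exp (- (1 / (real n + 1)) * (norm y)\<^sup>2) * (cmod (fourier u y))\<^sup>2" for n y
  proof -
    have "exp (- (1 / (real n + 1)) * (norm y)\<^sup>2) = (exp (- (1 / (2 * (real n + 1))) * (norm y)\<^sup>2))\<^sup>2"
      by (simp add: power2_eq_square flip: exp_add) (simp add: field_simps)
    then show ?thesis by (simp add: v_def norm_mult power_mult_distrib)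
  qed
  have vm: "v n \<in> borel_measurable borel" for n
    unfolding v_def by measurable
  have vL2: "v n \<in> L2" for n
  proof (rule L2_dominated[OF vm])
    show "integrable lborel (\<lambda>y::'a. exp (- (1 / (real n + 1)) * (norm y)\<^sup>2) * c\<^sup>2)"
      by (intro integrable_mult_left gaussian_integral) simp
    show "AE y in lborel. (cmod (v n y))\<^sup>2 \<le> exp (- (1 / (real n + 1)) * (norm y)\<^sup>2) * c\<^sup>2"
      unfolding vsq by (intro AE_I2 mult_left_mono power_mono c) auto
  qed
  have vnorm: "l2norm (v n) \<le> l2norm u" for n
  proof (rule power2_le_imp_le)
    have t: "0 < 1 / (real n + 1)" by simp
    have "complex_of_real ((l2norm (v n))\<^sup>2) = (LINT y|lborel. complex_of_real ((cmod (v n y))\<^sup>2))"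
      unfolding l2norm_power2 by (rule integral_of_real[symmetric, OF L2_integrable[OF vL2]])
    also have "\<dots> = (LINT y|lborel. complex_of_real (exp (- (1 / (real n + 1)) * (norm y)\<^sup>2)) * (fourier u y * cnj (fourier u y)))"
      unfolding vsq by (simp only: of_real_mult complex_norm_square)
    also have "\<dots> = heat_form (1 / (real n + 1)) u u"
      by (rule fourier_heat_form[OF t u(1) u(1)])
    finally have "(l2norm (v n))\<^sup>2 = cmod (heat_form (1 / (real n + 1)) u u)"
      by (metis norm_of_real abs_of_nonneg zero_le_power2)
    also have "\<dots> \<le> (l2norm u)\<^sup>2"
      using heat_form_bound[OF t u(2) u(2)] by (simp only: power2_eq_square)
    finally show "(l2norm (v n))\<^sup>2 \<le> (l2norm u)\<^sup>2" .
  qed simp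
  have lim: "(\<lambda>n. v n y) \<longlonglongrightarrow> fourier u y" for y
  proof -
    have "(\<lambda>n. 1 / (2 * (real n + 1))) \<longlonglongrightarrow> 0" by real_asymp
    then have "(\<lambda>n. complex_of_real (exp (- (1 / (2 * (real n + 1))) * (norm y)\<^sup>2)) * fourier u y)
        \<longlonglongrightarrow> complex_of_real (exp (- 0 * (norm y)\<^sup>2)) * fourier u y"
      by (intro tendsto_intros)
    then show ?thesis by (simp add: v_def)
  qed
  have fm: "fourier u \<in> borel_measurable borel" by measurable
  show "fourier u \<in> L2"
    by (rule L2_Fatou(1)[of v, OF vL2 fm AE_I2[OF lim] vnorm])
  show "l2norm (fourier u) \<le> l2norm u"
    by (rule L2_Fatou(2)[of v, OF vL2 fm AE_I2[OF lim] vnorm])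
qed

lemma fourier_diff_L2:
  fixes u w :: "'a::euclidean_space \<Rightarrow> complex"
  assumes u: "integrable lborel u" "u \<in> L2" and w: "integrable lborel w" "w \<in> L2"
  shows "l2norm (\<lambda>y. fourier u y - fourier w y) \<le> l2norm (\<lambda>x. u x - w x)"
proof -
  have "fourier (\<lambda>x. u x - w x) = (\<lambda>y. fourier u y - fourier w y)"
    by (rule ext) (rule fourier_diff[OF u(1) w(1)])
  then show ?thesis
    using fourier_L2_contraction(2)[OF Bochner_Integration.integrable_diff[OF u(1) w(1)] L2_diff[OF u(2) w(2)]]
    by simp
qed

text \<open>Both sides are limits of the same heat forms as t \<rightarrow> 0: on the position side
  the kernel concentrates, on the frequency side the damping factor tends to 1.\<close>

lemma fourier_parseval_bounded_continuous:
  fixes u g :: "'a::euclidean_space \<Rightarrow> complex"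
  assumes u: "integrable lborel u" "u \<in> L2" and g: "integrable lborel g" "g \<in> L2"
    and gc: "continuous_on UNIV g" "bounded (range g)"
  shows "l2inner (fourier u) (fourier g) = l2inner u g"
proof (rule LIMSEQ_unique)
  define t where "t n = 1 / (real n + 1)" for n
  have t: "0 < t n" for n by (simp add: t_def)
  have t0: "t \<longlonglongrightarrow> 0" unfolding t_def by real_asymp
  show "(\<lambda>n. heat_form (t n) u g) \<longlonglongrightarrow> l2inner u g"
    by (rule heat_form_initial[OF u(1) gc t t0])
  have [measurable]: "u \<in> borel_measurable borel" "g \<in> borel_measurable borel" using u g by auto
  have int: "integrable lborel (\<lambda>y. fourier u y * cnj (fourier g y))"
    by (intro integrable_L2_mult fourier_L2_contraction u g)
  show "(\<lambda>n. heat_form (t n) u g) \<longlonglongrightarrow> l2inner (fourier u) (fourier g)"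
    unfolding fourier_heat_form[OF t u(1) g(1), symmetric] l2inner_def
  proof (rule integral_dominated_convergence[OF _ _ integrable_norm[OF int]])
    show "AE y in lborel. (\<lambda>n. complex_of_real (exp (- t n * (norm y)\<^sup>2)) * (fourier u y * cnj (fourier g y)))
        \<longlonglongrightarrow> fourier u y * cnj (fourier g y)"
    proof (intro AE_I2)
      fix y :: 'a
      have "(\<lambda>n. complex_of_real (exp (- t n * (norm y)\<^sup>2)) * (fourier u y * cnj (fourier g y)))
        \<longlonglongrightarrow> complex_of_real (exp (- 0 * (norm y)\<^sup>2)) * (fourier u y * cnj (fourier g y))"
        by (intro tendsto_intros t0)
      then show "(\<lambda>n. complex_of_real (exp (- t n * (norm y)\<^sup>2)) * (fourier u y * cnj (fourier g y)))
        \<longlonglongrightarrow> fourier u y * cnj (fourier g y)" by simp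
    qed
    show "AE y in lborel. norm (complex_of_real (exp (- t n * (norm y)\<^sup>2)) * (fourier u y * cnj (fourier g y)))
      \<le> norm (fourier u y * cnj (fourier g y))" for n
    proof (intro AE_I2)
      fix y :: 'a
      have "exp (- t n * (norm y)\<^sup>2) \<le> 1" using t[of n] by simp
      then show "norm (complex_of_real (exp (- t n * (norm y)\<^sup>2)) * (fourier u y * cnj (fourier g y)))
        \<le> norm (fourier u y * cnj (fourier g y))"
        unfolding norm_mult[of "complex_of_real (exp _)"] by (intro mult_left_le_one_le) auto
    qed
  qed measurable
qed

text \<open>At this rate consecutive terms differ by at most (1/2)^n in norm, as
  \<open>L2_complete\<close> demands.\<close>

lemma L2_approx_sequence:
  fixes g :: "'a::euclidean_space \<Rightarrow> complex"
  assumes "g \<in> L2"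
  obtains w where "\<And>n::nat. continuous_on UNIV (w n)" "\<And>n. bounded (range (w n))"
    "\<And>n. integrable lborel (w n)" "\<And>n. w n \<in> L2"
    "\<And>n. l2norm (\<lambda>x. w n x - g x) < (1 / 2) ^ (n + 1)"
proof -
  have "\<forall>n::nat. \<exists>w. continuous_on UNIV w \<and> bounded (range w) \<and> integrable lborel w \<and> w \<in> L2 \<and>
    l2norm (\<lambda>x. w x - g x) < (1 / 2) ^ (n + 1)"
    by (intro allI L2_continuous_dense assms) simp
  then show thesis using that by metis
qed

lemma l2norm_tendsto_0_if_geometric:
  assumes "\<And>n. l2norm (\<lambda>x. w n x - g x) < (1 / 2) ^ (n + 1)"
  shows "(\<lambda>n. l2norm (\<lambda>x. w n x - g x)) \<longlonglongrightarrow> 0"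
proof (rule Lim_null_comparison)
  show "(\<lambda>n. (1 / 2) ^ (n + 1)) \<longlonglongrightarrow> (0::real)"
    by real_asymp
  show "\<forall>\<^sub>F n in sequentially. norm (l2norm (\<lambda>x. w n x - g x)) \<le> (1 / 2) ^ (n + 1)"
    using assms less_imp_le by (intro always_eventually) auto
qed

text \<open>Continuity and boundedness of g are removed by density; the contraction property carries
  the approximation over to the transforms.\<close>

lemma fourier_parseval:
  fixes u g :: "'a::euclidean_space \<Rightarrow> complex"
  assumes u: "integrable lborel u" "u \<in> L2" and g: "integrable lborel g" "g \<in> L2"
  shows "l2inner (fourier u) (fourier g) = l2inner u g"
proof -
  obtain w where w: "\<And>n::nat. continuous_on UNIV (w n)" "\<And>n. bounded (range (w n))"
    "\<And>n. integrable lborel (w n)" "\<And>n. w n \<in> L2"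
    "\<And>n. l2norm (\<lambda>x. w n x - g x) < (1 / 2) ^ (n + 1)"
    using L2_approx_sequence[OF g(2)] by blast
  note lim = l2norm_tendsto_0_if_geometric[of w, OF w(5)]
  have flim: "(\<lambda>n. l2norm (\<lambda>y. fourier (w n) y - fourier g y)) \<longlonglongrightarrow> 0"
    by (rule Lim_null_comparison[OF _ lim]) (use fourier_diff_L2[OF w(3,4) g] in simp)
  have const: "(\<lambda>n. l2norm (\<lambda>x. f x - f x)) \<longlonglongrightarrow> 0" for f :: "'a \<Rightarrow> complex"
    by (simp add: l2norm_def)
  have "(\<lambda>n. l2inner (fourier u) (fourier (w n))) \<longlonglongrightarrow> l2inner (fourier u) (fourier g)"
    by (intro l2inner_tendsto const flim fourier_L2_contraction u g w)
  moreover have "(\<lambda>n. l2inner u (w n)) \<longlonglongrightarrow> l2inner u g"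
    by (intro l2inner_tendsto const lim u g w)
  ultimately show ?thesis
    using LIMSEQ_unique fourier_parseval_bounded_continuous[OF u w(3,4,1,2)] by simp
qed

text \<open>By contraction, the transforms of fast approximants are again fast Cauchy. Test
  functions such as sgn(\<psi>) \<open>\<phi>\<^sub>0\<close> are known only to lie in L2, so a
  transform has to be produced for every such function.\<close>

lemma fourier_L2_exists:
  fixes g :: "'a::euclidean_space \<Rightarrow> complex"
  assumes g: "g \<in> L2"
  shows "\<exists>g'. fourier_L2 g g'"
proof -
  obtain w where w: "\<And>n::nat. continuous_on UNIV (w n)" "\<And>n. bounded (range (w n))"
    "\<And>n. integrable lborel (w n)" "\<And>n. w n \<in> L2"
    "\<And>n. l2norm (\<lambda>x. w n x - g x) < (1 / 2) ^ (n + 1)"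
    using L2_approx_sequence[OF g] by blast
  have "l2norm (\<lambda>y. fourier (w (Suc n)) y - fourier (w n) y) \<le> (1 / 2) ^ n" for n
  proof -
    have "l2norm (\<lambda>y. fourier (w (Suc n)) y - fourier (w n) y) \<le> l2norm (\<lambda>x. w (Suc n) x - w n x)"
      by (rule fourier_diff_L2[OF w(3,4) w(3,4)])
    also have "\<dots> \<le> l2norm (\<lambda>x. w (Suc n) x - g x) + l2norm (\<lambda>x. g x - w n x)"
      by (rule l2norm_triangle_diff[OF w(4) w(4) g])
    also have "\<dots> \<le> (1 / 2) ^ (n + 1) + (1 / 2) ^ (n + 1)"
    proof (rule add_mono)
      have "(1 / 2) ^ (Suc n + 1) \<le> (1 / 2 :: real) ^ (n + 1)" by simp
      then show "l2norm (\<lambda>x. w (Suc n) x - g x) \<le> (1 / 2) ^ (n + 1)"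
        using w(5)[of "Suc n"] by linarith
      show "l2norm (\<lambda>x. g x - w n x) \<le> (1 / 2) ^ (n + 1)"
        using w(5)[of n] by (simp add: l2norm_minus_commute[of g])
    qed
    finally show ?thesis by simp
  qed
  then obtain g' where g': "g' \<in> L2" "(\<lambda>n. l2norm (\<lambda>y. fourier (w n) y - g' y)) \<longlonglongrightarrow> 0"
    using L2_complete[of "\<lambda>n. fourier (w n)", OF fourier_L2_contraction(1)[OF w(3,4)]] by blast
  then have "fourier_L2 g g'"
    unfolding fourier_L2_def using g w(3,4) l2norm_tendsto_0_if_geometric[of w, OF w(5)] by blast
  then show ?thesis by blast
qed

lemma fourier_L2_D: "fourier_L2 f f' \<Longrightarrow> f \<in> L2 \<and> f' \<in> L2"
  by (simp add: fourier_L2_def)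

lemma fourier_L2_parseval:
  fixes f g :: "'a::euclidean_space \<Rightarrow> complex"
  assumes f: "fourier_L2 f f'" and g: "fourier_L2 g g'"
  shows "l2inner f' g' = l2inner f g"
proof -
  obtain u where u: "\<And>n::nat. u n \<in> L2" "\<And>n. integrable lborel (u n)"
      "(\<lambda>n. l2norm (\<lambda>x. u n x - f x)) \<longlonglongrightarrow> 0" "(\<lambda>n. l2norm (\<lambda>y. fourier (u n) y - f' y)) \<longlonglongrightarrow> 0"
    using f unfolding fourier_L2_def by blast
  obtain w where w: "\<And>n::nat. w n \<in> L2" "\<And>n. integrable lborel (w n)"
      "(\<lambda>n. l2norm (\<lambda>x. w n x - g x)) \<longlonglongrightarrow> 0" "(\<lambda>n. l2norm (\<lambda>y. fourier (w n) y - g' y)) \<longlonglongrightarrow> 0"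
    using g unfolding fourier_L2_def by blast
  have "(\<lambda>n. l2inner (u n) (w n)) \<longlonglongrightarrow> l2inner f g"
    using fourier_L2_D[OF f] fourier_L2_D[OF g] by (intro l2inner_tendsto u w) auto
  moreover have "(\<lambda>n. l2inner (fourier (u n)) (fourier (w n))) \<longlonglongrightarrow> l2inner f' g'"
    using fourier_L2_D[OF f] fourier_L2_D[OF g]
    by (intro l2inner_tendsto fourier_L2_contraction u w) auto
  ultimately show ?thesis
    using fourier_parseval[OF u(2,1) w(2,1)] LIMSEQ_unique by simp
qed

text \<open>P_t is the multiplier exp(-t |y|^2) on all of L2. Both sides are continuous in the L2
  norm, the left one because the factor has modulus at most 1, so the identity extends from the
  approximants.\<close>

lemma fourier_L2_heat_form:
  fixes f g :: "'a::euclidean_space \<Rightarrow> complex"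
  assumes t: "0 < t" and f: "fourier_L2 f f'" and g: "fourier_L2 g g'"
  shows "l2inner (\<lambda>y. complex_of_real (exp (- t * (norm y)\<^sup>2)) * f' y) g' = heat_form t f g"
proof -
  define e where "e y = complex_of_real (exp (- t * (norm y)\<^sup>2))" for y :: 'a
  have em: "e \<in> borel_measurable borel" unfolding e_def by measurable
  have eb: "cmod (e y) \<le> 1" for y
    using t by (simp add: e_def)
  have eL2: "(\<lambda>y. e y * h y) \<in> L2" if "h \<in> L2" for h
    by (rule L2_bounded_mult[OF that em eb])
  obtain u where u: "\<And>n::nat. u n \<in> L2" "\<And>n. integrable lborel (u n)"
      "(\<lambda>n. l2norm (\<lambda>x. u n x - f x)) \<longlonglongrightarrow> 0" "(\<lambda>n. l2norm (\<lambda>y. fourier (u n) y - f' y)) \<longlonglongrightarrow> 0"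
    using f unfolding fourier_L2_def by blast
  obtain w where w: "\<And>n::nat. w n \<in> L2" "\<And>n. integrable lborel (w n)"
      "(\<lambda>n. l2norm (\<lambda>x. w n x - g x)) \<longlonglongrightarrow> 0" "(\<lambda>n. l2norm (\<lambda>y. fourier (w n) y - g' y)) \<longlonglongrightarrow> 0"
    using g unfolding fourier_L2_def by blast
  have elim: "(\<lambda>n. l2norm (\<lambda>y. e y * fourier (u n) y - e y * f' y)) \<longlonglongrightarrow> 0"
  proof (rule Lim_null_comparison[OF _ u(4)], intro always_eventually allI)
    fix n
    have d: "(\<lambda>y. fourier (u n) y - f' y) \<in> L2"
      using fourier_L2_D[OF f] by (intro L2_diff fourier_L2_contraction u) auto
    have "(l2norm (\<lambda>y. e y * (fourier (u n) y - f' y)))\<^sup>2 \<le> (l2norm (\<lambda>y. fourier (u n) y - f' y))\<^sup>2"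
      unfolding l2norm_power2
    proof (rule integral_mono[OF L2_integrable[OF eL2[OF d]] L2_integrable[OF d]])
      fix y :: 'a
      have "cmod (e y) * cmod (fourier (u n) y - f' y) \<le> cmod (fourier (u n) y - f' y)"
        using eb[of y] by (intro mult_left_le_one_le) auto
      then show "(cmod (e y * (fourier (u n) y - f' y)))\<^sup>2 \<le> (cmod (fourier (u n) y - f' y))\<^sup>2"
        by (intro power_mono) (auto simp: norm_mult)
    qed
    then have "l2norm (\<lambda>y. e y * (fourier (u n) y - f' y)) \<le> l2norm (\<lambda>y. fourier (u n) y - f' y)"
      by (rule power2_le_imp_le) simp
    then show "norm (l2norm (\<lambda>y. e y * fourier (u n) y - e y * f' y)) \<le> l2norm (\<lambda>y. fourier (u n) y - f' y)"
      by (simp add: right_diff_distrib)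
  qed
  have "(\<lambda>n. heat_form t (u n) (w n)) \<longlonglongrightarrow> heat_form t f g"
    using fourier_L2_D[OF f] fourier_L2_D[OF g] by (intro heat_form_tendsto t u w) auto
  moreover have "(\<lambda>n. l2inner (\<lambda>y. e y * fourier (u n) y) (fourier (w n))) \<longlonglongrightarrow> l2inner (\<lambda>y. e y * f' y) g'"
    using fourier_L2_D[OF f] fourier_L2_D[OF g]
    by (intro l2inner_tendsto elim eL2 fourier_L2_contraction u w) auto
  moreover have "l2inner (\<lambda>y. e y * fourier (u n) y) (fourier (w n)) = heat_form t (u n) (w n)" for n
    unfolding l2inner_def e_def using fourier_heat_form[OF t u(2) w(2), of n n] by (simp add: mult.assoc)
  ultimately show ?thesis
    using LIMSEQ_unique by (simp add: e_def)
qed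

section \<open>Orthogonal transformations\<close>

lemma nn_integral_lborel_translate:
  assumes [measurable]: "f \<in> borel_measurable borel"
  shows "(\<integral>\<^sup>+x. f (c + x) \<partial>lborel) = (\<integral>\<^sup>+x. f x \<partial>lborel)"
proof -
  have "(\<integral>\<^sup>+x. f x \<partial>lborel) = (\<integral>\<^sup>+x. f x \<partial>distr lborel borel ((+) c))"
    by (simp add: lborel_distr_plus)
  then show ?thesis by (simp add: nn_integral_distr)
qed

text \<open>The uniqueness argument for Haar measure: both measures are translation invariant and agree on
  the unit ball.\<close>

lemma lborel_distr_orthogonal:
  fixes S :: "'a::euclidean_space \<Rightarrow> 'a"
  assumes S: "orthogonal_transformation S"
  shows "distr lborel borel S = lborel"
proof (rule measure_eqI)
  fix A :: "'a set" assume "A \<in> sets (distr lborel borel S)"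
  then have A [measurable]: "A \<in> sets borel" by simp
  have lin: "linear S" and nS: "\<And>x. norm (S x) = norm x"
    using S by (auto simp: orthogonal_transformation)
  then have [measurable]: "S \<in> borel_measurable borel"
    by (intro borel_measurable_continuous_onI linear_continuous_on) (simp add: linear_conv_bounded_linear)
  define u :: "'a \<Rightarrow> ennreal" where "u = indicator (ball 0 1)"
  define f :: "'a \<Rightarrow> ennreal" where "f = indicator A"
  define V where "V = emeasure lborel (ball (0::'a) 1)"
  have [measurable]: "u \<in> borel_measurable borel" "f \<in> borel_measurable borel"
    by (auto simp: u_def f_def intro!: borel_measurable_indicator A)
  have uS: "u (S y) = u y" for y by (simp add: u_def nS indicator_def)
  have uV: "(\<integral>\<^sup>+y. u y \<partial>lborel) = V" by (simp add: u_def V_def)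
  have uz: "(\<integral>\<^sup>+x. u (z - x) \<partial>lborel) = V" for z
  proof -
    have "u (z - x) = u (- z + x)" for x
      by (simp add: u_def indicator_def norm_minus_commute)
    then show ?thesis using nn_integral_lborel_translate[of u "- z"] uV by simp
  qed
  have "V * (\<integral>\<^sup>+x. f x \<partial>lborel) = (\<integral>\<^sup>+y. u (S y) * (\<integral>\<^sup>+x. f x \<partial>lborel) \<partial>lborel)"
    by (subst nn_integral_multc) (simp_all add: uS uV)
  also have "\<dots> = (\<integral>\<^sup>+y. \<integral>\<^sup>+x. u (S y) * f (S y + x) \<partial>lborel \<partial>lborel)"
    by (simp add: nn_integral_cmult nn_integral_lborel_translate)
  also have "\<dots> = (\<integral>\<^sup>+x. \<integral>\<^sup>+y. u (S y) * f (S y + x) \<partial>lborel \<partial>lborel)"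
    by (rule lborel_pair.Fubini'[symmetric]) simp
  also have "\<dots> = (\<integral>\<^sup>+x. \<integral>\<^sup>+y. u (S y - x) * f (S y) \<partial>lborel \<partial>lborel)"
  proof (rule nn_integral_cong)
    fix x
    \<comment> \<open>Shifting y by -z moves x = S z out of the argument of f and into that of the
      ball's indicator, whose integral over x does not depend on S y.\<close>
    obtain z where z: "S z = x"
      using orthogonal_transformation_surj[OF S] by (metis surjD)
    have "S (- z + y) = S y - x" for y
      using linear_diff[OF lin, of y z] z by simp
    then show "(\<integral>\<^sup>+y. u (S y) * f (S y + x) \<partial>lborel) = (\<integral>\<^sup>+y. u (S y - x) * f (S y) \<partial>lborel)"
      using nn_integral_lborel_translate[of "\<lambda>y. u (S y) * f (S y + x)" "- z"] by simp
  qed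
  also have "\<dots> = (\<integral>\<^sup>+y. \<integral>\<^sup>+x. u (S y - x) * f (S y) \<partial>lborel \<partial>lborel)"
    by (rule lborel_pair.Fubini') simp
  also have "\<dots> = V * (\<integral>\<^sup>+y. f (S y) \<partial>lborel)"
    by (simp add: nn_integral_multc nn_integral_cmult uz)
  finally have eq: "V * (\<integral>\<^sup>+x. f x \<partial>lborel) = V * (\<integral>\<^sup>+y. f (S y) \<partial>lborel)" .
  have "V \<noteq> \<infinity>"
    using emeasure_bounded_finite[of "ball (0::'a) 1"] by (simp add: V_def)
  moreover have "V \<noteq> 0"
  proof
    assume "V = 0"
    then have "negligible (ball (0::'a) 1)"
      by (auto simp: V_def negligible_iff_null_sets null_sets_def emeasure_completion)
    then show False using open_not_negligible[of "ball (0::'a) 1"] by auto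
  qed
  ultimately have "(\<integral>\<^sup>+x. f x \<partial>lborel) = (\<integral>\<^sup>+y. f (S y) \<partial>lborel)"
    using eq by (simp add: ennreal_mult_cancel_left)
  moreover have "(\<integral>\<^sup>+y. f (S y) \<partial>lborel) = (\<integral>\<^sup>+y. f y \<partial>distr lborel borel S)"
    by (simp add: nn_integral_distr)
  ultimately show "emeasure (distr lborel borel S) A = emeasure lborel A"
    by (simp add: f_def)
qed simp

lemma L2_comp_measure_preserving:
  assumes S: "distr lborel borel S = lborel" and [measurable]: "S \<in> borel_measurable borel" and f: "f \<in> L2"
  shows "(\<lambda>x. f (S x)) \<in> L2"
proof (rule L2I)
  have [measurable]: "f \<in> borel_measurable borel" using f by (rule L2_measurable)
  show "(\<lambda>x. f (S x)) \<in> borel_measurable borel" by measurable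
  have "integrable (distr lborel borel S) (\<lambda>x. (cmod (f x))\<^sup>2)"
    using L2_integrable[OF f] by (simp add: S)
  then show "integrable lborel (\<lambda>x. (cmod (f (S x)))\<^sup>2)"
    by (subst (asm) integrable_distr_eq) simp_all
qed

lemma integral_comp_measure_preserving:
  fixes f :: "_ \<Rightarrow> 'b::{banach, second_countable_topology}"
  assumes S: "distr lborel borel S = lborel" and [measurable]: "S \<in> borel_measurable borel" "f \<in> borel_measurable borel"
  shows "(LINT x|lborel. f (S x)) = (LINT x|lborel. f x)"
  using integral_distr[of S lborel borel f] by (simp add: S)

text \<open>P_t commutes with orthogonal maps: applying S to both coordinates preserves the product
  measure and the distance between the two points.\<close>

lemma heat_form_orthogonal:
  fixes S :: "'a::euclidean_space \<Rightarrow> 'a"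
  assumes S: "orthogonal_transformation S"
    and [measurable]: "f \<in> borel_measurable borel" "g \<in> borel_measurable borel"
  shows "heat_form t (\<lambda>x. f (S x)) (\<lambda>x. g (S x)) = heat_form t f g"
proof -
  have lin: "linear S" and nS: "\<And>x. norm (S x) = norm x"
    using S by (auto simp: orthogonal_transformation)
  then have S_meas [measurable]: "S \<in> borel_measurable borel"
    by (intro borel_measurable_continuous_onI linear_continuous_on) (simp add: linear_conv_bounded_linear)
  define T where "T p = (S (fst p), S (snd p))" for p
  have [measurable]: "T \<in> borel_measurable borel"
    unfolding T_def borel_prod[symmetric] by measurable
  have sf: "sigma_finite_measure (distr lborel borel S)"
    unfolding lborel_distr_orthogonal[OF S] by (rule sigma_finite_lborel)
  have "distr (lborel \<Otimes>\<^sub>M lborel) (borel \<Otimes>\<^sub>M borel) (\<lambda>(x, y). (S x, S y)) = distr lborel borel S \<Otimes>\<^sub>M distr lborel borel S"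
    by (rule pair_measure_distr[symmetric]) (use sf in simp_all)
  then have T: "distr lborel borel T = lborel"
    by (simp add: lborel_distr_orthogonal[OF S] lborel_prod borel_prod T_def[abs_def] case_prod_unfold)
  have k: "heat_kernel t (S x - S y) = heat_kernel t (x - y)" for x y
    using nS[of "x - y"] by (simp add: heat_kernel_def linear_diff[OF lin])
  show ?thesis
    unfolding heat_form_def
    using integral_comp_measure_preserving[OF T _ heat_form_measurable[of f g t]]
    by (simp add: T_def k)
qed

section \<open>The operator as a superposition of heat kernels\<close>

text \<open>Up to a constant factor, the jump density of the \<beta>-stable subordinator. The
  indicator lets every integral over time range over the whole line.\<close>

definition levy_density :: "real \<Rightarrow> real \<Rightarrow> real" where
  "levy_density \<beta> t = indicator {0<..} t * t powr (- 1 - \<beta>)"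

text \<open>For 0 < \<beta> < 1, integration by parts gives the value Gamma(1 - \<beta>) /
  \<beta>.\<close>

definition levy_const :: "real \<Rightarrow> real" where
  "levy_const \<beta> = (LINT t|lborel. levy_density \<beta> t * (1 - exp (- t)))"

lemma levy_density_nonneg [simp]: "0 \<le> levy_density \<beta> t"
  by (simp add: levy_density_def)

lemma levy_density_measurable [measurable]: "levy_density \<beta> \<in> borel_measurable borel"
  unfolding levy_density_def[abs_def] by measurable

text \<open>Near 0 the bound 1 - exp(-t) \<le> t leaves t^(-\<beta>), integrable because \<beta> <
  1; at infinity t^(-1-\<beta>) is integrable because \<beta> > 0.\<close>

lemma levy_density_integrable:
  assumes b: "0 < \<beta>" "\<beta> < 1"
  shows "integrable lborel (\<lambda>t. levy_density \<beta> t * (1 - exp (- t)))"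
proof (rule Bochner_Integration.integrable_bound)
  have "(\<lambda>t. t powr (- \<beta>)) absolutely_integrable_on {0..1}"
    using has_integral_powr_from_0[of "- \<beta>" 1] b
    by (intro nonnegative_absolutely_integrable_1) (auto simp: integrable_on_def)
  then have 1: "integrable lborel (\<lambda>t. indicator {0..1} t *\<^sub>R t powr (- \<beta>))"
    unfolding set_integrable_def by (subst (asm) integrable_completion) auto
  have "(\<lambda>t. t powr (- 1 - \<beta>)) absolutely_integrable_on {1..}"
    using has_integral_powr_to_inf[of "- 1 - \<beta>" 1] b
    by (intro nonnegative_absolutely_integrable_1) (auto simp: integrable_on_def)
  then have 2: "integrable lborel (\<lambda>t. indicator {1..} t *\<^sub>R t powr (- 1 - \<beta>))"
    unfolding set_integrable_def by (subst (asm) integrable_completion) auto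
  show "integrable lborel (\<lambda>t. indicator {0..1} t *\<^sub>R t powr (- \<beta>) + indicator {1..} t *\<^sub>R t powr (- 1 - \<beta>))"
    by (intro Bochner_Integration.integrable_add 1 2)
  show "AE t in lborel. norm (levy_density \<beta> t * (1 - exp (- t)))
      \<le> norm (indicator {0..1} t *\<^sub>R t powr (- \<beta>) + indicator {1..} t *\<^sub>R t powr (- 1 - \<beta>))"
  proof (intro AE_I2)
    fix t :: real
    consider "t \<le> 0" | "0 < t" "t \<le> 1" | "1 < t" by linarith
    then show "norm (levy_density \<beta> t * (1 - exp (- t)))
      \<le> norm (indicator {0..1} t *\<^sub>R t powr (- \<beta>) + indicator {1..} t *\<^sub>R t powr (- 1 - \<beta>))"
    proof cases
      case 1
      then show ?thesis by (simp add: levy_density_def)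
    next
      case 2
      have "t powr (- 1 - \<beta>) * (1 - exp (- t)) \<le> t powr (- 1 - \<beta>) * t"
        using exp_ge_add_one_self[of "- t"] by (intro mult_left_mono) auto
      also have "\<dots> = t powr (- \<beta>)"
        using 2 by (simp add: powr_diff powr_minus powr_one field_simps)
      finally have "t powr (- 1 - \<beta>) * (1 - exp (- t)) \<le> t powr (- \<beta>)" .
      moreover have "0 \<le> t powr (- 1 - \<beta>) * (1 - exp (- t))" using 2 by simp
      \<comment> \<open>This serves the endpoint t = 1, where the two intervals of the majorant
        overlap.\<close>
      moreover have "- 1 \<le> exp (- 1 :: real)" by (rule order_trans[OF _ exp_ge_zero]) simp
      ultimately show ?thesis using 2
        by (auto simp: levy_density_def indicator_def)
    next
      case 3
      have "t powr (- 1 - \<beta>) * (1 - exp (- t)) \<le> t powr (- 1 - \<beta>)"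
        by (intro mult_left_le) auto
      moreover have "0 \<le> t powr (- 1 - \<beta>) * (1 - exp (- t))" using 3 by simp
      ultimately show ?thesis using 3
        by (auto simp: levy_density_def indicator_def)
    qed
  qed
qed simp

text \<open>The substitution s t for t extracts s^\<beta> from the case s = 1, which defines the
  constant. At s = 0 both sides vanish, since \<open>0 powr \<beta>\<close> is 0.\<close>

lemma levy_representation:
  assumes b: "0 < \<beta>" "\<beta> < 1" and s: "0 \<le> s"
  shows "integrable lborel (\<lambda>t. levy_density \<beta> t * (1 - exp (- t * s)))" (is ?I)
    and "(LINT t|lborel. levy_density \<beta> t * (1 - exp (- t * s))) = levy_const \<beta> * s powr \<beta>" (is ?V)
proof -
  have "?I \<and> ?V"
  proof (cases "s = 0")
    case False
    with s have s: "0 < s" by simp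
    define F where "F t = levy_density \<beta> t * (1 - exp (- t))" for t
    have F: "integrable lborel F" unfolding F_def by (rule levy_density_integrable[OF b])
    have eq: "levy_density \<beta> t * (1 - exp (- t * s)) = (s powr (1 + \<beta>)) * F (0 + s * t)" for t
    proof (cases "0 < t")
      case True
      have "(s * t) powr (- 1 - \<beta>) = s powr (- (1 + \<beta>)) * t powr (- 1 - \<beta>)"
        using s True by (simp add: powr_mult)
      moreover have "s powr (1 + \<beta>) * s powr (- (1 + \<beta>)) = 1"
        using s by (simp flip: powr_add)
      ultimately show ?thesis
        using s True by (simp add: F_def levy_density_def mult.commute)
    qed (use s in \<open>simp add: F_def levy_density_def zero_less_mult_iff\<close>)
    have "levy_const \<beta> = s *\<^sub>R (LINT t|lborel. F (0 + s * t))"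
      using lborel_integral_real_affine[of s F 0] s by (simp add: levy_const_def F_def)
    then have "(s powr (1 + \<beta>)) * (LINT t|lborel. F (0 + s * t)) = levy_const \<beta> * s powr \<beta>"
      using s by (simp add: powr_add)
    then show ?thesis
      unfolding eq using lborel_integrable_real_affine[OF F, of s 0] s by simp
  qed (use b in simp)
  then show ?I ?V by auto
qed

text \<open>Insert \<open>levy_representation\<close> at \<open>s = (norm y)\<^sup>2 + M\<close> on the Fourier side.\<close>

lemma levy_heat_representation:
  fixes f g :: "'a::euclidean_space \<Rightarrow> complex"
  assumes b: "0 < \<beta>" "\<beta> < 1" and M: "0 \<le> M"
    and f: "fourier_L2 f f'" and h: "fourier_L2 h h'" and g: "g \<in> L2"
    and mult: "AE y in lborel. h' y = complex_of_real (((norm y)\<^sup>2 + M) powr \<beta> - m) * f' y"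
  defines "E \<equiv> \<lambda>t. l2inner f g - complex_of_real (exp (- t * M)) * heat_form t f g"
  shows "integrable lborel (\<lambda>t. complex_of_real (levy_density \<beta> t) * E t)"
    and "(LINT t|lborel. complex_of_real (levy_density \<beta> t) * E t) = levy_const \<beta> * (l2inner h g + m * l2inner f g)"
proof -
  obtain g' where g': "fourier_L2 g g'" using fourier_L2_exists[OF g] by blast
  have L2: "f' \<in> L2" "h' \<in> L2" "g' \<in> L2"
    using fourier_L2_D[OF f] fourier_L2_D[OF h] fourier_L2_D[OF g'] by auto
  have [measurable]: "f' \<in> borel_measurable borel" "g' \<in> borel_measurable borel"
    using L2 by (auto simp: L2_measurable)
  define s where "s y = (norm y)\<^sup>2 + M" for y :: 'a
  have s: "0 \<le> s y" for y using M by (simp add: s_def)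
  have [measurable]: "s \<in> borel_measurable borel" unfolding s_def[abs_def] by measurable
  define \<mu> where "\<mu> t y = levy_density \<beta> t * (1 - exp (- t * s y))" for t y
  have mu0: "0 \<le> \<mu> t y" for t y
    using s[of y] by (cases "0 < t") (auto simp: \<mu>_def levy_density_def)
  define H where "H p = complex_of_real (\<mu> (snd p) (fst p)) * (f' (fst p) * cnj (g' (fst p)))" for p
  have Hm: "H \<in> borel_measurable borel"
    unfolding H_def \<mu>_def borel_prod[symmetric] by measurable
  \<comment> \<open>The factor s^\<beta> f' equals h' + m f' and is therefore in L2. This is where
    membership of f in the operator domain pays for absolute convergence, so that g may be an
    arbitrary L2 function.\<close>
  have mult': "AE y in lborel. complex_of_real (s y powr \<beta>) * (f' y * cnj (g' y)) = h' y * cnj (g' y) + m * (f' y * cnj (g' y))"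
    using mult
  proof eventually_elim
    case (elim y)
    then have "complex_of_real (s y powr \<beta>) * f' y = h' y + m * f' y"
      by (simp add: s_def algebra_simps)
    then show ?case
      by (simp add: distrib_right flip: mult.assoc)
  qed
  have i1: "integrable lborel (\<lambda>y. h' y * cnj (g' y))" and i2: "integrable lborel (\<lambda>y. f' y * cnj (g' y))"
    by (intro integrable_L2_mult L2)+
  have i3: "integrable lborel (\<lambda>y. complex_of_real (s y powr \<beta>) * (f' y * cnj (g' y)))"
  proof (subst integrable_cong_AE[OF _ _ mult'])
    show "integrable lborel (\<lambda>y. h' y * cnj (g' y) + m * (f' y * cnj (g' y)))"
      by (intro Bochner_Integration.integrable_add integrable_mult_right i1 i2)
  qed (use L2 in \<open>auto simp: L2_measurable\<close>)
  have muint: "integrable lborel (\<lambda>t. \<mu> t y)" "(LINT t|lborel. \<mu> t y) = levy_const \<beta> * s y powr \<beta>" for y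
    unfolding \<mu>_def by (rule levy_representation[OF b s])+
  have Hint: "integrable lborel H"
  proof (rule lborel_Fubini_integrable[OF Hm])
    \<comment> \<open>As \<mu> is nonnegative, the t-integral of the modulus is evaluated exactly,
      and the Fubini condition becomes integrability of s^\<beta> f' against g'.\<close>
    have "(LINT t|lborel. norm (H (y, t))) = levy_const \<beta> * norm (complex_of_real (s y powr \<beta>) * (f' y * cnj (g' y)))" for y
    proof -
      have "norm (H (y, t)) = \<mu> t y * norm (f' y * cnj (g' y))" for t
        using mu0[of t y] by (simp add: H_def norm_mult)
      then show ?thesis by (simp add: muint norm_mult)
    qed
    then show "integrable lborel (\<lambda>y. LINT t|lborel. norm (H (y, t)))"
      using integrable_norm[OF i3] by simp
    show "AE y in lborel. integrable lborel (\<lambda>t. H (y, t))"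
      unfolding H_def fst_conv snd_conv
      by (intro AE_I2 integrable_mult_left integrable_of_real muint)
  qed
  have inner: "(LINT y|lborel. H (y, t)) = complex_of_real (levy_density \<beta> t) * E t" for t
  proof (cases "0 < t")
    case True
    have e: "(\<lambda>y. complex_of_real (exp (- t * (norm y)\<^sup>2)) * f' y) \<in> L2"
      using True by (intro L2_bounded_mult[OF L2(1), where B = 1]) auto
    have "H (y, t) = complex_of_real (levy_density \<beta> t) * (f' y * cnj (g' y) -
        complex_of_real (exp (- t * M)) * ((complex_of_real (exp (- t * (norm y)\<^sup>2)) * f' y) * cnj (g' y)))" for y
    proof -
      have "exp (- t * s y) = exp (- t * M) * exp (- t * (norm y)\<^sup>2)"
        by (simp add: s_def distrib_left flip: exp_add)
      then show ?thesis by (simp add: H_def \<mu>_def algebra_simps)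
    qed
    then have "(LINT y|lborel. H (y, t)) = complex_of_real (levy_density \<beta> t) * (l2inner f' g' -
        complex_of_real (exp (- t * M)) * l2inner (\<lambda>y. complex_of_real (exp (- t * (norm y)\<^sup>2)) * f' y) g')"
      unfolding l2inner_def using integrable_L2_mult[OF e L2(3)] i2 by simp
    then show ?thesis
      by (simp only: fourier_L2_parseval[OF f g'] fourier_L2_heat_form[OF True f g'] E_def)
  qed (simp add: H_def \<mu>_def levy_density_def)
  have "integrable lborel (\<lambda>t. LINT y|lborel. H (y, t))"
    using lborel_pair.integrable_snd[of "\<lambda>y t. H (y, t)"] Hint by (simp add: lborel_prod)
  then show "integrable lborel (\<lambda>t. complex_of_real (levy_density \<beta> t) * E t)"
    by (simp only: inner)
  have "(LINT t|lborel. complex_of_real (levy_density \<beta> t) * E t) = (LINT y|lborel. LINT t|lborel. H (y, t))"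
    using lborel_integral_fst[OF Hint] lborel_integral_snd[OF Hint] by (simp add: inner)
  also have "\<dots> = (LINT y|lborel. levy_const \<beta> * (complex_of_real (s y powr \<beta>) * (f' y * cnj (g' y))))"
    by (simp add: H_def muint mult.assoc)
  also have "\<dots> = levy_const \<beta> * (LINT y|lborel. complex_of_real (s y powr \<beta>) * (f' y * cnj (g' y)))"
    by simp
  also have "(LINT y|lborel. complex_of_real (s y powr \<beta>) * (f' y * cnj (g' y)))
      = (LINT y|lborel. h' y * cnj (g' y) + m * (f' y * cnj (g' y)))"
    by (rule integral_cong_AE[OF _ _ mult']) (use L2 in \<open>auto simp: L2_measurable\<close>)
  also have "\<dots> = l2inner h' g' + m * l2inner f' g'"
    using i1 i2 by (simp add: l2inner_def)
  also have "\<dots> = l2inner h g + m * l2inner f g"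
    by (simp only: fourier_L2_parseval[OF f g'] fourier_L2_parseval[OF h g'])
  finally show "(LINT t|lborel. complex_of_real (levy_density \<beta> t) * E t) = levy_const \<beta> * (l2inner h g + m * l2inner f g)" .
qed

section \<open>Symmetry of positive solutions\<close>

text \<open>Nonempty open sets have positive measure. It is used twice below: to pick one positive
  time, and to pick a pair of points at which \<psi> has opposite signs.\<close>

lemma AE_lborel_open_witness:
  fixes U :: "'a::euclidean_space set"
  assumes "AE x in lborel. P x" "open U" "U \<noteq> {}"
  obtains x where "x \<in> U" "P x"
proof -
  have "\<exists>x\<in>U. P x"
  proof (rule ccontr)
    assume "\<not> (\<exists>x\<in>U. P x)"
    then have "AE x in lborel. x \<notin> U"
      using assms(1) by (auto elim: eventually_mono)
    then have "U \<in> null_sets lborel"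
      using assms(2) by (subst AE_iff_null_sets) auto
    then have "negligible U"
      by (simp add: negligible_iff_null_sets null_sets_completionI)
    then show False using open_not_negligible assms by blast
  qed
  then show thesis using that by blast
qed

lemma heat_form_symmetric:
  assumes "f \<in> borel_measurable borel" "g \<in> borel_measurable borel"
  shows "heat_form t f g = heat_form t (\<lambda>x. cnj (g x)) (\<lambda>x. cnj (f x))"
  using lborel_integral_swap[OF heat_form_measurable[OF assms, of t]]
  by (simp add: heat_form_def heat_kernel_commute mult_ac)

text \<open>An integrated inequality of Kato type: for positive \<phi> the integrand
  \<open>D\<close> is nonnegative, and it measures how far the signs of \<psi> at the two points
  disagree.\<close>

lemma heat_form_sign_defect:
  fixes \<phi> \<psi> :: "'a::euclidean_space \<Rightarrow> real"
  assumes t: "0 < t"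
    and \<phi>: "(\<lambda>x. complex_of_real (\<phi> x)) \<in> L2" and \<psi>: "(\<lambda>x. complex_of_real (\<psi> x)) \<in> L2"
    and k: "(\<lambda>x. complex_of_real \<bar>\<psi> x\<bar>) \<in> L2" and g: "(\<lambda>x. complex_of_real (sgn (\<psi> x) * \<phi> x)) \<in> L2"
  defines "D \<equiv> \<lambda>q. heat_kernel t (fst q - snd q) * (\<phi> (fst q) * (\<bar>\<psi> (snd q)\<bar> - sgn (\<psi> (fst q)) * \<psi> (snd q)))"
  shows "integrable lborel D"
    and "heat_form t (\<lambda>x. complex_of_real (\<phi> x)) (\<lambda>x. complex_of_real \<bar>\<psi> x\<bar>)
      - heat_form t (\<lambda>x. complex_of_real (\<psi> x)) (\<lambda>x. complex_of_real (sgn (\<psi> x) * \<phi> x))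
      = complex_of_real (LINT q|lborel. D q)"
proof -
  note I1 = heat_form_integrable[OF t k \<phi>] and I2 = heat_form_integrable[OF t \<psi> g]
  \<comment> \<open>Swapping the slots puts |\<psi>| at the second point and \<phi> at the first, as
    in the other form, so the difference can be taken pointwise.\<close>
  have sym: "heat_form t (\<lambda>x. complex_of_real (\<phi> x)) (\<lambda>x. complex_of_real \<bar>\<psi> x\<bar>)
      = heat_form t (\<lambda>x. complex_of_real \<bar>\<psi> x\<bar>) (\<lambda>x. complex_of_real (\<phi> x))"
    using heat_form_symmetric[OF L2_measurable[OF \<phi>] L2_measurable[OF k]] by simp
  have eq: "complex_of_real (heat_kernel t (fst q - snd q)) * complex_of_real \<bar>\<psi> (snd q)\<bar> * cnj (complex_of_real (\<phi> (fst q)))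
      - complex_of_real (heat_kernel t (fst q - snd q)) * complex_of_real (\<psi> (snd q)) * cnj (complex_of_real (sgn (\<psi> (fst q)) * \<phi> (fst q)))
      = complex_of_real (D q)" for q
    by (simp add: D_def algebra_simps)
  have "integrable lborel (\<lambda>q. complex_of_real (D q))"
    unfolding eq[symmetric] by (intro Bochner_Integration.integrable_diff I1 I2)
  then show "integrable lborel D" by (simp only: complex_of_real_integrable_eq)
  show "heat_form t (\<lambda>x. complex_of_real (\<phi> x)) (\<lambda>x. complex_of_real \<bar>\<psi> x\<bar>)
      - heat_form t (\<lambda>x. complex_of_real (\<psi> x)) (\<lambda>x. complex_of_real (sgn (\<psi> x) * \<phi> x))
      = complex_of_real (LINT q|lborel. D q)"
    unfolding sym
    unfolding heat_form_def Bochner_Integration.integral_diff[OF I1 I2, symmetric] eq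
    by (rule integral_complex_of_real)
qed

text \<open>The operator enters only through its weak equation against L2 test functions, with a
  bounded S-invariant weight W. The constant c stays arbitrary because the combination of pairings
  that it multiplies is 0.\<close>

lemma positive_solution_symmetric:
  fixes \<phi> W :: "'a::euclidean_space \<Rightarrow> real" and S :: "'a \<Rightarrow> 'a"
  assumes S: "orthogonal_transformation S" "\<And>x. S (S x) = x"
    and \<phi>: "continuous_on UNIV \<phi>" "\<And>x. 0 < \<phi> x" "(\<lambda>x. complex_of_real (\<phi> x)) \<in> L2"
    and W: "W \<in> borel_measurable borel" "\<And>x. \<bar>W x\<bar> \<le> B" "\<And>x. W (S x) = W x"
    and int: "\<And>g. g \<in> L2 \<Longrightarrow> integrable lborel (\<lambda>t. complex_of_real (levy_density \<beta> t) *
        (l2inner (\<lambda>x. complex_of_real (\<phi> x)) g - complex_of_real (exp (- t * M)) * heat_form t (\<lambda>x. complex_of_real (\<phi> x)) g))"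
    and eqn: "\<And>g. g \<in> L2 \<Longrightarrow> (LINT t|lborel. complex_of_real (levy_density \<beta> t) *
        (l2inner (\<lambda>x. complex_of_real (\<phi> x)) g - complex_of_real (exp (- t * M)) * heat_form t (\<lambda>x. complex_of_real (\<phi> x)) g))
      = c * l2inner (\<lambda>x. complex_of_real (W x) * complex_of_real (\<phi> x)) g"
  shows "\<phi> (S x) = \<phi> x"
proof (rule ccontr)
  assume ne: "\<phi> (S x) \<noteq> \<phi> x"
  have lin: "linear S" using S by (simp add: orthogonal_transformation)
  then have Sc: "continuous_on UNIV S"
    by (intro linear_continuous_on) (simp add: linear_conv_bounded_linear)
  then have Sm [measurable]: "S \<in> borel_measurable borel"
    by (rule borel_measurable_continuous_onI)
  note Sd = lborel_distr_orthogonal[OF S(1)]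
  have \<phi>m [measurable]: "\<phi> \<in> borel_measurable borel"
    using \<phi>(1) by (rule borel_measurable_continuous_onI)
  note [measurable] = W(1)
  define \<psi> where "\<psi> x = \<phi> x - \<phi> (S x)" for x
  have \<psi>c: "continuous_on UNIV \<psi>"
    unfolding \<psi>_def by (intro continuous_intros \<phi>(1) continuous_on_compose2[OF \<phi>(1) Sc]) auto
  then have [measurable]: "\<psi> \<in> borel_measurable borel"
    by (rule borel_measurable_continuous_onI)
  have \<psi>S: "\<psi> (S x) = - \<psi> x" for x by (simp add: \<psi>_def S)
  define f where "f x = complex_of_real (\<phi> x)" for x
  define fS where "fS x = f (S x)" for x
  define p where "p x = complex_of_real (\<psi> x)" for x
  define k where "k x = complex_of_real \<bar>\<psi> x\<bar>" for x
  define g1 where "g1 x = complex_of_real (sgn (\<psi> x) * \<phi> x)" for x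
  \<comment> \<open>Pairing \<phi> \<circ> S with \<open>g1\<close> is the same as pairing \<phi>
    with \<open>g2\<close>, because S is a measure-preserving involution. The equation of \<psi>
    tested with \<open>g1\<close> is thus the equation of \<phi> tested with \<open>g1\<close> minus
    that with \<open>g2\<close>.\<close>
  define g2 where "g2 x = g1 (S x)" for x
  have f: "f \<in> L2" using \<phi>(3) by (simp add: f_def[abs_def])
  have fS: "fS \<in> L2"
    unfolding fS_def[abs_def] by (rule L2_comp_measure_preserving[OF Sd Sm f])
  have p_eq: "p = (\<lambda>x. f x - fS x)" by (simp add: fun_eq_iff p_def f_def fS_def \<psi>_def)
  then have p: "p \<in> L2" using L2_diff[OF f fS] by simp
  have k: "k \<in> L2"
    by (rule L2_dominated[OF _ L2_integrable[OF p]]) (auto simp: k_def[abs_def] p_def)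
  have g1: "g1 \<in> L2"
  proof -
    have "(\<lambda>x. complex_of_real (sgn (\<psi> x)) * f x) \<in> L2"
      by (rule L2_bounded_mult[OF f, where B = 1]) (auto simp: sgn_real_def)
    then show ?thesis by (simp add: g1_def[abs_def] f_def)
  qed
  have g2: "g2 \<in> L2"
    unfolding g2_def[abs_def] by (rule L2_comp_measure_preserving[OF Sd Sm g1])
  note L2s = f fS p k g1 g2
  note [measurable] = L2s[THEN L2_measurable]
  \<comment> \<open>The cancellation rests on \<psi> sgn(\<psi>) \<phi> = \<phi> |\<psi>|. It is
    used with w = 1 for the unsmoothed inner products under the t-integral and with w = W for the
    right-hand sides.\<close>
  have pairing: "l2inner (\<lambda>x. complex_of_real (w x) * f x) g1 - l2inner (\<lambda>x. complex_of_real (w x) * f x) g2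
      - l2inner (\<lambda>x. complex_of_real (w x) * f x) k = 0"
    if [measurable]: "w \<in> borel_measurable borel" and wb: "\<And>x. \<bar>w x\<bar> \<le> b" and wS: "\<And>x. w (S x) = w x" for w b
  proof -
    have wL2: "(\<lambda>x. complex_of_real (w x) * u x) \<in> L2" if "u \<in> L2" for u
      by (rule L2_bounded_mult[OF that, where B = b]) (use wb in auto)
    have "l2inner (\<lambda>x. complex_of_real (w x) * f x) g2 = (LINT x|lborel. (\<lambda>x. complex_of_real (w x) * fS x * cnj (g1 x)) (S x))"
      by (simp add: l2inner_def g2_def fS_def wS S)
    also have "\<dots> = l2inner (\<lambda>x. complex_of_real (w x) * fS x) g1"
      unfolding l2inner_def by (rule integral_comp_measure_preserving[OF Sd Sm]) measurable
    finally have "l2inner (\<lambda>x. complex_of_real (w x) * f x) g1 - l2inner (\<lambda>x. complex_of_real (w x) * f x) g2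
      = l2inner (\<lambda>x. complex_of_real (w x) * p x) g1"
      using l2inner_diff(1)[OF wL2[OF f] wL2[OF fS] g1] by (simp add: p_eq right_diff_distrib)
    also have "\<dots> = l2inner (\<lambda>x. complex_of_real (w x) * f x) k"
    proof -
      have "complex_of_real (w x) * p x * cnj (g1 x) = complex_of_real (w x) * f x * cnj (k x)" for x
        by (simp add: p_def g1_def f_def k_def sgn_if abs_if)
      then show ?thesis by (simp only: l2inner_def)
    qed
    finally show ?thesis by simp
  qed
  define D where "D t q = heat_kernel t (fst q - snd q) * (\<phi> (fst q) * (\<bar>\<psi> (snd q)\<bar> - sgn (\<psi> (fst q)) * \<psi> (snd q)))" for t q
  have D0: "0 \<le> D t q" for t q
  proof -
    have "sgn (\<psi> (fst q)) * \<psi> (snd q) \<le> \<bar>\<psi> (snd q)\<bar>"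
      by (auto simp: sgn_if)
    then show ?thesis
      using \<phi>(2)[of "fst q"] by (simp add: D_def)
  qed
  define E where "E g t = l2inner f g - complex_of_real (exp (- t * M)) * heat_form t f g" for g t
  define N where "N t = (LINT q|lborel. D t q)" for t
  have N0: "0 \<le> N t" for t unfolding N_def using D0 by simp
  have fun_eqs: "f = (\<lambda>x. complex_of_real (\<phi> x))" "p = (\<lambda>x. complex_of_real (\<psi> x))"
    "k = (\<lambda>x. complex_of_real \<bar>\<psi> x\<bar>)" "g1 = (\<lambda>x. complex_of_real (sgn (\<psi> x) * \<phi> x))"
    "D = (\<lambda>t q. heat_kernel t (fst q - snd q) * (\<phi> (fst q) * (\<bar>\<psi> (snd q)\<bar> - sgn (\<psi> (fst q)) * \<psi> (snd q))))"
    unfolding f_def p_def k_def g1_def D_def by (rule refl)+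
  have Dint: "integrable lborel (D t)" and Dval: "heat_form t f k - heat_form t p g1 = complex_of_real (N t)"
    if "0 < t" for t
    using heat_form_sign_defect[OF that f[unfolded fun_eqs] p[unfolded fun_eqs] k[unfolded fun_eqs] g1[unfolded fun_eqs]]
    unfolding fun_eqs N_def by blast+
  \<comment> \<open>The heat forms enter \<open>E\<close> with a minus sign, so subtracting the
    equation tested with |\<psi>| leaves the sign defect with a plus sign. Times t \<le> 0 are
    killed by the density.\<close>
  have comb: "complex_of_real (levy_density \<beta> t) * (E g1 t - E g2 t - E k t)
      = complex_of_real (levy_density \<beta> t * (exp (- t * M) * N t))" for t
  proof (cases "0 < t")
    case True
    have "heat_form t f g2 = heat_form t fS g1"
      using heat_form_orthogonal[OF S(1), of fS g1 t] by (simp add: fS_def g2_def[abs_def] S)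
    then have "heat_form t f g1 - heat_form t f g2 = heat_form t p g1"
      using heat_form_diff(1)[OF True f fS g1] by (simp add: p_eq)
    moreover have "heat_form t f k - heat_form t p g1 = complex_of_real (N t)"
      by (rule Dval[OF True])
    moreover have "l2inner f g1 - l2inner f g2 - l2inner f k = 0"
      using pairing[of "\<lambda>_. 1" 1] by simp
    moreover have "E g1 t - E g2 t - E k t = (l2inner f g1 - l2inner f g2 - l2inner f k)
        + complex_of_real (exp (- t * M)) * (heat_form t f k - (heat_form t f g1 - heat_form t f g2))"
      by (simp add: E_def algebra_simps)
    ultimately show ?thesis by simp
  qed (simp add: levy_density_def)
  note ints = int[folded f_def, folded f_def[abs_def], folded E_def]
  note eqns = eqn[folded f_def, folded f_def[abs_def], folded E_def]
  have Rint: "integrable lborel (\<lambda>t. complex_of_real (levy_density \<beta> t) * (E g1 t - E g2 t - E k t))"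
    unfolding right_diff_distrib by (intro Bochner_Integration.integrable_diff ints g1 g2 k)
  then have Rint': "integrable lborel (\<lambda>t. levy_density \<beta> t * (exp (- t * M) * N t))"
    unfolding comb by (simp only: complex_of_real_integrable_eq)
  have "complex_of_real (LINT t|lborel. levy_density \<beta> t * (exp (- t * M) * N t))
      = (LINT t|lborel. complex_of_real (levy_density \<beta> t) * (E g1 t - E g2 t - E k t))"
    unfolding comb by (rule integral_complex_of_real[symmetric])
  also have "\<dots> = c * l2inner (\<lambda>x. complex_of_real (W x) * f x) g1 - c * l2inner (\<lambda>x. complex_of_real (W x) * f x) g2
      - c * l2inner (\<lambda>x. complex_of_real (W x) * f x) k"
    unfolding right_diff_distrib
    by (simp only: Bochner_Integration.integral_diff Bochner_Integration.integrable_diff ints eqns g1 g2 k)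
  also have "\<dots> = 0"
    using pairing[OF W] by (simp flip: right_diff_distrib)
  finally have "(LINT t|lborel. levy_density \<beta> t * (exp (- t * M) * N t)) = 0"
    by simp
  then have "AE t in lborel. levy_density \<beta> t * (exp (- t * M) * N t) = 0"
    by (subst (asm) integral_nonneg_eq_0_iff_AE[OF Rint']) (auto intro!: AE_I2 mult_nonneg_nonneg N0)
  then obtain t where t: "0 < t" "levy_density \<beta> t * (exp (- t * M) * N t) = 0"
    by (rule AE_lborel_open_witness[of _ "{0<..}"]) auto
  then have "N t = 0" by (simp add: levy_density_def)
  then have ae: "AE q in lborel. D t q = 0"
    unfolding N_def by (subst (asm) integral_nonneg_eq_0_iff_AE[OF Dint[OF t(1)]]) (auto simp: D0)
  have "\<psi> x \<noteq> 0" using ne by (simp add: \<psi>_def)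
  then obtain y where y: "0 < \<psi> y"
    using \<psi>S[of x] by (metis linorder_neqE_linordered_idom neg_0_less_iff_less)
  \<comment> \<open>Because of the sign function \<open>D t\<close> may be discontinuous, so its
    vanishing almost everywhere is contradicted on an open set: on U the bracket equals -2 \<psi>(z)
    > 0. Oddness of \<psi> shows that U is nonempty.\<close>
  define U where "U = {x. 0 < \<psi> x} \<times> {x. \<psi> x < 0}"
  have "open U"
    unfolding U_def
    by (intro open_Times open_Collect_less continuous_on_const \<psi>c)
  moreover have "(y, S y) \<in> U" using y by (simp add: U_def \<psi>S)
  ultimately obtain q where q: "q \<in> U" "D t q = 0"
    using AE_lborel_open_witness[OF ae] by blast
  then show False
    using heat_kernel_pos[OF t(1), of "fst q - snd q"] \<phi>(2)[of "fst q"]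
    by (auto simp: U_def D_def)
qed

section \<open>Reflections in hyperplanes through the origin, and the symmetry of the ground
  state\<close>

lemma reflection_linear_hyperplane:
  fixes a :: "'a::euclidean_space"
  assumes a: "a \<noteq> 0"
  shows "orthogonal_transformation (reflection {x. a \<bullet> x = 0})"
    and "reflection {x. a \<bullet> x = 0} (reflection {x. a \<bullet> x = 0} x) = x"
proof -
  have eq: "reflection {x. a \<bullet> x = 0} x = x - (2 * (a \<bullet> x) / (a \<bullet> a)) *\<^sub>R a" for x
    using reflection_hyperplane[OF a, of 0] by simp
  have aa: "a \<bullet> a \<noteq> 0" using a by simp
  show "orthogonal_transformation (reflection {x. a \<bullet> x = 0})"
    unfolding orthogonal_transformation_def
  proof (intro conjI allI)
    show "linear (reflection {x. a \<bullet> x = 0})"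
      by (rule linearI) (simp_all add: eq inner_add_right add_divide_distrib algebra_simps)
    show "reflection {x. a \<bullet> x = 0} v \<bullet> reflection {x. a \<bullet> x = 0} w = v \<bullet> w" for v w
      unfolding eq using aa by (simp add: inner_diff_left inner_diff_right inner_commute field_simps)
  qed
  show "reflection {x. a \<bullet> x = 0} (reflection {x. a \<bullet> x = 0} x) = x"
    using aa by (simp add: eq inner_diff_right)
qed

theorem theorem4p2:
  fixes \<alpha> m v b :: real
    and a :: "real ^ 'd"
    and K \<H> :: "(real ^ 'd) set"
    and S :: "real ^ 'd \<Rightarrow> real ^ 'd"
    and \<phi>\<^sub>0 :: "real ^ 'd \<Rightarrow> real"
  assumes alpha: "0 < \<alpha>" "\<alpha> < 2"
    and m: "0 \<le> m"
    and hyperplane: "a \<noteq> 0" "\<H> = {x. a \<bullet> x = b}" "0 \<in> \<H>"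
    and S: "S = reflection \<H>"
    and K: "K \<in> sets borel" "bounded K" "interior K \<noteq> {}"
    and K_symmetric: "S ` K = K"
    and v: "0 < v"
    and ground: "ground_state (H_op m \<alpha> v K) (\<lambda>x. complex_of_real (\<phi>\<^sub>0 x))"
    and continuous: "continuous_on UNIV \<phi>\<^sub>0"
    and positive: "\<forall>x. 0 < \<phi>\<^sub>0 x"
    and normalised: "l2norm (\<lambda>x. complex_of_real (\<phi>\<^sub>0 x)) = 1"
  shows "\<forall>x. \<phi>\<^sub>0 (S x) = \<phi>\<^sub>0 x"
proof
  fix x
  define f where "f x = complex_of_real (\<phi>\<^sub>0 x)" for x
  define e0 where "e0 = inf_spec (H_op m \<alpha> v K)"
  have "b = 0" using hyperplane by simp
  then have S0: "S = reflection {x. a \<bullet> x = 0}" using S hyperplane by simp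
  have S_orth: "orthogonal_transformation S" and S_inv: "\<And>x. S (S x) = x"
    using reflection_linear_hyperplane[OF hyperplane(1)] by (simp_all add: S0)
  from ground obtain h where h: "(f, h) \<in> L_op m \<alpha>"
    and eigen: "AE x in lborel. complex_of_real e0 * f x = h x - complex_of_real (v * indicator K x) * f x"
    by (auto simp: ground_state_def H_op_def f_def[abs_def] e0_def)
  from h obtain f' h' where f': "fourier_L2 f f'" and h': "fourier_L2 h h'"
    and mult: "AE y in lborel. h' y = complex_of_real (((norm y)\<^sup>2 + m powr (2 / \<alpha>)) powr (\<alpha> / 2) - m) * f' y"
    by (auto simp: L_op_def fourier_multiplier_def Phi_def)
  have f: "f \<in> L2" and hL2: "h \<in> L2"
    using fourier_L2_D[OF f'] fourier_L2_D[OF h'] by auto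
  \<comment> \<open>The superposition represents L + m, so m is added to both sides and the
    potential moves to the right: (L + m) f = W f. The symmetry of K makes W invariant under
    S.\<close>
  define W where "W x = e0 + m + v * indicator K x" for x
  have W_meas: "W \<in> borel_measurable borel"
    using K(1) unfolding W_def[abs_def] by measurable
  have W_bound: "\<bar>W x\<bar> \<le> \<bar>e0\<bar> + \<bar>m\<bar> + \<bar>v\<bar>" for x
    by (auto simp: W_def indicator_def)
  have W_sym: "W (S x) = W x" for x
  proof -
    have "S x \<in> K \<longleftrightarrow> x \<in> K"
      using K_symmetric S_inv by (metis imageI)
    then show ?thesis by (simp add: W_def indicator_def)
  qed
  have b: "0 < \<alpha> / 2" "\<alpha> / 2 < 1" and M: "0 \<le> m powr (2 / \<alpha>)"
    using alpha by auto
  have weight: "l2inner h g + m * l2inner f g = l2inner (\<lambda>x. complex_of_real (W x) * f x) g" if g: "g \<in> L2" for g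
  proof -
    have "l2inner h g + m * l2inner f g = (LINT x|lborel. h x * cnj (g x) + m * (f x * cnj (g x)))"
      using integrable_L2_mult[OF hL2 g] integrable_L2_mult[OF f g] by (simp add: l2inner_def)
    also have "\<dots> = (LINT x|lborel. complex_of_real (W x) * f x * cnj (g x))"
    proof (rule integral_cong_AE)
      show "AE x in lborel. h x * cnj (g x) + m * (f x * cnj (g x)) = complex_of_real (W x) * f x * cnj (g x)"
        using eigen
      proof eventually_elim
        case (elim x)
        then have "h x = (complex_of_real e0 + complex_of_real (v * indicator K x)) * f x"
          by (simp add: algebra_simps)
        then show ?case by (simp add: W_def algebra_simps)
      qed
    qed (use f hL2 g W_meas in \<open>auto simp: L2_measurable\<close>)
    finally show ?thesis by (simp add: l2inner_def)
  qed
  note rep = levy_heat_representation[OF b M f' h' _ mult]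
  show "\<phi>\<^sub>0 (S x) = \<phi>\<^sub>0 x"
  proof (rule positive_solution_symmetric[OF S_orth S_inv continuous _ _ W_meas W_bound W_sym])
    show "0 < \<phi>\<^sub>0 x" for x using positive by simp
    show "(\<lambda>x. complex_of_real (\<phi>\<^sub>0 x)) \<in> L2" using f by (simp add: f_def[abs_def])
  qed (use rep weight in \<open>simp_all add: f_def[abs_def]\<close>)
qed

end
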